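(* Let $\mathcal{R}$ be a reduced root system with irreducible finite Weyl group $W$ and reflection representation $V\cong\mathbb{C}^N$, and let $m\colon\mathcal{R}\to\mathbb{N}$ be a $W$-invariant multiplicity function. Then $$D(Cat)^W\cong\mathrm{Hom}_W(V,Q_m^{tr,V})\qquad\text{and}\qquad Q_m^{tr,V}\cong D(Cat)^W\otimes V$$ as modules over $(SV^* )^W\otimes\mathbb{C}W$ (in the first isomorphism $W$ acts trivially on both sides).
   Context: $\mathbb{N}=\{0,1,2,\dots\}$. $(\cdot,\cdot)$ is the standard $W$-invariant bilinear scalar product on $V$, $x_1,\dots,x_N$ the corresponding orthonormal coordinates, $SV^*=\mathbb{C}[x_1,\dots,x_N]$; reflections act by $s_\alpha(x)=x-(\alpha,x)\alpha^\vee$, $\alpha^\vee=2\alpha/(\alpha,\alpha)$, $\alpha\in\mathcal{R}$; $\mathcal{R}_+$ is a positive half of $\mathcal{R}$; $m_\alpha=m(\alpha)$. $W$ acts on $SV^*$ by $(wf)(x)=f(w^{-1}x)$. Non-homogeneous (trigonometric) quasi-invariants: $Q_m^{tr}$ is the ring of polynomials $p\in SV^*$ such that for every $\alpha\in\mathcal{R}$ one has $p(x+\frac12j\alpha^\vee)=p(x-\frac12j\alpha^\vee)$ for all $x\in V$ with $(\alpha,x)=0$ and all $j=1,\dots,m_\alpha$. It is an $(SV^* )^W\otimes\mathbb{C}W$-module, and $Q_m^{tr,V}$ denotes its isotypic component of the irreducible $W$-module $V\cong V^*$. Catalan arrangement: $Cat$ is the affine arrangement of the hyperplanes $\Pi_{\alpha,j}=\{x\in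 V\colon(\alpha,x)=j\}$, $\alpha\in\mathcal{R}_+$, $-m_\alpha\le j\le m_\alpha$ ($j$ integer). $\mathrm{Der}$ is the $SV^*$-module of derivations $L=\sum_ia_i\partial_{x_i}$ of $SV^*$, with $W$-action $(wL)(\varphi)=w(L(w^{-1}\varphi))$. $D(Cat)=\{L\in\mathrm{Der}\colon((\alpha,x)-j)\text{ divides }L((\alpha,x))\text{ for all }\alpha\in\mathcal{R},\ -m_\alpha\le j\le m_\alpha\}$, and $D(Cat)^W$ is its subspace of $W$-invariant elements. *)

theory Defs
  imports "HOL-Analysis.Analysis" "HOL-Algebra.Bij" "HOL-Algebra.Free_Abelian_Groups"
begin

unbundle no m_inv_syntax

section \<open>Root systems and Weyl groups\<close>

text \<open>
  The complexified reflection representation is \<open>V = complex ^ 'n\<close>, in coordinates that are orthonormal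
  for the standard invariant form. That form is bilinear (not Hermitian), so it is
  \<^const>\<open>scalar_product\<close>; the roots lie in the real form, i.e. have real coordinates.
\<close>

definition coroot :: "complex ^ 'n \<Rightarrow> complex ^ 'n" where
  "coroot \<alpha> = (2 / scalar_product \<alpha> \<alpha>) *s \<alpha>"

definition reflection :: "complex ^ 'n \<Rightarrow> complex ^ 'n \<Rightarrow> complex ^ 'n" where
  "reflection \<alpha> x = x - scalar_product \<alpha> x *s coroot \<alpha>"

definition root_system :: "(complex ^ 'n) set \<Rightarrow> bool" where
  "root_system R \<longleftrightarrow>
     finite R \<and> 0 \<notin> R \<and> (\<forall>\<alpha>\<in>R. \<forall>i. \<alpha> $ i \<in> \<real>) \<and> vec.span R = UNIV \<and>
     (\<forall>\<alpha>\<in>R. reflection \<alpha> ` R = R) \<and>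
     (\<forall>\<alpha>\<in>R. \<forall>\<beta>\<in>R. scalar_product \<beta> (coroot \<alpha>) \<in> \<int>)"

definition reduced :: "(complex ^ 'n) set \<Rightarrow> bool" where
  "reduced R \<longleftrightarrow> (\<forall>\<alpha>\<in>R. \<forall>c. c *s \<alpha> \<in> R \<longrightarrow> c = 1 \<or> c = -1)"

definition irreducible_roots :: "(complex ^ 'n) set \<Rightarrow> bool" where
  "irreducible_roots R \<longleftrightarrow> R \<noteq> {} \<and>
     \<not> (\<exists>A B. A \<noteq> {} \<and> B \<noteq> {} \<and> A \<inter> B = {} \<and> A \<union> B = R \<and>
            (\<forall>\<alpha>\<in>A. \<forall>\<beta>\<in>B. scalar_product \<alpha> \<beta> = 0))"

definition weyl_group :: "(complex ^ 'n) set \<Rightarrow> (complex ^ 'n \<Rightarrow> complex ^ 'n) set" where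
  "weyl_group R = generate (BijGroup UNIV) (reflection ` R)"

section \<open>The polynomial ring and the action of W\<close>

type_synonym 'n pol = "('n \<Rightarrow>\<^sub>0 nat) \<Rightarrow>\<^sub>0 complex"

definition Const :: "complex \<Rightarrow> 'n pol" where
  "Const c = Poly_Mapping.single 0 c"

definition Var :: "'n \<Rightarrow> 'n pol" where
  "Var i = Poly_Mapping.single (Poly_Mapping.single i 1) 1"

definition cscale :: "complex \<Rightarrow> 'n pol \<Rightarrow> 'n pol" where
  "cscale c p = Const c * p"

definition eval :: "'n::finite pol \<Rightarrow> complex ^ 'n \<Rightarrow> complex" where
  "eval p x = (\<Sum>t\<in>Poly_Mapping.keys p. Poly_Mapping.lookup p t * (\<Prod>i\<in>UNIV. x $ i ^ Poly_Mapping.lookup t i))"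

text \<open>The linear form \<open>x \<mapsto> (v, x)\<close>.\<close>

definition linear_form :: "complex ^ 'n::finite \<Rightarrow> 'n pol" where
  "linear_form v = (\<Sum>i\<in>UNIV. Const (v $ i) * Var i)"

text \<open>
  \<open>(w f)(x) = f(w\<^sup>-\<^sup>1 x)\<close>: the variable \<open>x_i\<close> is replaced by the \<open>i\<close>-th coordinate of \<open>w\<^sup>-\<^sup>1 x\<close>,
  which is the linear form given by the \<open>i\<close>-th row of the matrix of \<open>w\<^sup>-\<^sup>1\<close>
  (see \<open>eval_act_weyl\<close> below).
\<close>

definition act :: "(complex ^ 'n \<Rightarrow> complex ^ 'n) \<Rightarrow> 'n::finite pol \<Rightarrow> 'n pol" where
  "act w f = (\<Sum>t\<in>Poly_Mapping.keys f. Const (Poly_Mapping.lookup f t) *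
     (\<Prod>i\<in>UNIV. linear_form (row i (matrix (inv w))) ^ Poly_Mapping.lookup t i))"

definition invariant_ring :: "(complex ^ 'n \<Rightarrow> complex ^ 'n) set \<Rightarrow> 'n::finite pol set" where
  "invariant_ring W = {f. \<forall>w\<in>W. act w f = f}"

section \<open>Trigonometric quasi-invariants\<close>

definition Q_tr :: "(complex ^ 'n) set \<Rightarrow> (complex ^ 'n \<Rightarrow> nat) \<Rightarrow> 'n::finite pol set" where
  "Q_tr R m = {p. \<forall>\<alpha>\<in>R. \<forall>x. scalar_product \<alpha> x = 0 \<longrightarrow>
     (\<forall>j\<in>{1..m \<alpha>}. eval p (x + (of_nat j / 2) *s coroot \<alpha>)
                = eval p (x - (of_nat j / 2) *s coroot \<alpha>))}"

definition W_linear ::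
    "(complex ^ 'n \<Rightarrow> complex ^ 'n) set \<Rightarrow> (complex ^ 'n \<Rightarrow> 'n::finite pol) \<Rightarrow> bool" where
  "W_linear W \<phi> \<longleftrightarrow> Vector_Spaces.linear (*s) cscale \<phi> \<and> (\<forall>w\<in>W. \<forall>v. \<phi> (w v) = act w (\<phi> v))"

text \<open>The \<open>V\<close>-isotypic component of a \<open>W\<close>-stable space \<open>S\<close> of polynomials: the sum of all
  \<open>W\<close>-submodules \<open>U\<close> of \<open>S\<close> that are isomorphic to \<open>V\<close>.\<close>

definition isotypic_V :: "(complex ^ 'n \<Rightarrow> complex ^ 'n) set \<Rightarrow> 'n::finite pol set \<Rightarrow> 'n pol set" where
  "isotypic_V W S = module.span cscale
     (\<Union> {U. U \<subseteq> S \<and> (\<exists>\<phi>. W_linear W \<phi> \<and> bij_betw \<phi> UNIV U)})"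

definition Hom_W :: "(complex ^ 'n \<Rightarrow> complex ^ 'n) set \<Rightarrow> 'n::finite pol set
    \<Rightarrow> (complex ^ 'n \<Rightarrow> 'n pol) set" where
  "Hom_W W S = {\<phi>. W_linear W \<phi> \<and> range \<phi> \<subseteq> S}"

section \<open>Logarithmic derivations of the Catalan arrangement\<close>

definition Der :: "('n::finite pol \<Rightarrow> 'n pol) set" where
  "Der = {L. Vector_Spaces.linear cscale cscale L \<and> (\<forall>p q. L (p * q) = L p * q + p * L q)}"

definition D_Cat ::
    "(complex ^ 'n) set \<Rightarrow> (complex ^ 'n \<Rightarrow> nat) \<Rightarrow> ('n::finite pol \<Rightarrow> 'n pol) set" where
  "D_Cat R m = {L \<in> Der. \<forall>\<alpha>\<in>R. \<forall>j::int. - int (m \<alpha>) \<le> j \<and> j \<le> int (m \<alpha>) \<longrightarrow>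
     (linear_form \<alpha> - Const (of_int j)) dvd L (linear_form \<alpha>)}"

definition act_der :: "(complex ^ 'n \<Rightarrow> complex ^ 'n)
    \<Rightarrow> ('n::finite pol \<Rightarrow> 'n pol) \<Rightarrow> 'n pol \<Rightarrow> 'n pol" where
  "act_der w L = (\<lambda>\<phi>. act w (L (act (inv w) \<phi>)))"

definition D_Cat_W ::
    "(complex ^ 'n) set \<Rightarrow> (complex ^ 'n \<Rightarrow> nat) \<Rightarrow> ('n::finite pol \<Rightarrow> 'n pol) set" where
  "D_Cat_W R m = {L \<in> D_Cat R m. \<forall>w\<in>weyl_group R. act_der w L = L}"

section \<open>Modules over \<open>A \<otimes> \<complex>W\<close>\<close>

text \<open>
  A module over \<open>A \<otimes> \<complex>W\<close> is given by an abelian group with commuting actions of the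
  \<open>\<complex>\<close>-algebra \<open>A\<close> and of the group \<open>W\<close>. As for \<^const>\<open>free_Abelian_group\<close>, the additive group is
  the \<^typ>\<open>'m monoid\<close> part. A map is \<open>A \<otimes> \<complex>W\<close>-linear iff it is additive and commutes with both
  actions (\<open>A\<close> contains the constants, so this includes \<open>\<complex>\<close>-linearity).
\<close>

record ('a, 'w, 'm) gmodule = "'m monoid" +
  scale :: "'a \<Rightarrow> 'm \<Rightarrow> 'm"
  gact :: "'w \<Rightarrow> 'm \<Rightarrow> 'm"

definition gmodule_iso ::
    "'a set \<Rightarrow> 'w set \<Rightarrow> ('a, 'w, 'm) gmodule \<Rightarrow> ('a, 'w, 'k) gmodule \<Rightarrow> bool" where
  "gmodule_iso A W M N \<longleftrightarrow> (\<exists>\<theta>\<in>iso M N. \<forall>x\<in>carrier M.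
     (\<forall>a\<in>A. \<theta> (scale M a x) = scale N a (\<theta> x)) \<and>
     (\<forall>w\<in>W. \<theta> (gact M w x) = gact N w (\<theta> x)))"

text \<open>The tensor product over \<open>\<complex>\<close> of two vector spaces, given by their additive groups \<open>G\<close>, \<open>H\<close> and
  their scalar multiplications \<open>s\<close>, \<open>t\<close>: the free abelian group on pairs modulo the subgroup
  generated by the biadditivity and balancing relations.\<close>

definition tensor_rels :: "'b monoid \<Rightarrow> (complex \<Rightarrow> 'b \<Rightarrow> 'b) \<Rightarrow> 'c monoid \<Rightarrow> (complex \<Rightarrow> 'c \<Rightarrow> 'c)
    \<Rightarrow> ('b \<times> 'c \<Rightarrow>\<^sub>0 int) set" where
  "tensor_rels G s H t =
     generate (free_Abelian_group (carrier G \<times> carrier H))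
      ({frag_of (a \<otimes>\<^bsub>G\<^esub> a', b) - frag_of (a, b) - frag_of (a', b) | a a' b.
          a \<in> carrier G \<and> a' \<in> carrier G \<and> b \<in> carrier H} \<union>
       {frag_of (a, b \<otimes>\<^bsub>H\<^esub> b') - frag_of (a, b) - frag_of (a, b') | a b b'.
          a \<in> carrier G \<and> b \<in> carrier H \<and> b' \<in> carrier H} \<union>
       {frag_of (s c a, b) - frag_of (a, t c b) | c a b. a \<in> carrier G \<and> b \<in> carrier H})"

definition tensor :: "'b monoid \<Rightarrow> (complex \<Rightarrow> 'b \<Rightarrow> 'b) \<Rightarrow> 'c monoid \<Rightarrow> (complex \<Rightarrow> 'c \<Rightarrow> 'c)
    \<Rightarrow> ('b \<times> 'c \<Rightarrow>\<^sub>0 int) set monoid" where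
  "tensor G s H t = free_Abelian_group (carrier G \<times> carrier H) Mod tensor_rels G s H t"

text \<open>The map \<open>f \<otimes> g\<close> on the tensor product. The image of a coset under the map induced on the
  free group need not be a whole coset, so the subgroup of relations is added back.\<close>

definition tensor_map :: "'b monoid \<Rightarrow> (complex \<Rightarrow> 'b \<Rightarrow> 'b) \<Rightarrow> 'c monoid \<Rightarrow> (complex \<Rightarrow> 'c \<Rightarrow> 'c)
    \<Rightarrow> ('b \<Rightarrow> 'b) \<Rightarrow> ('c \<Rightarrow> 'c) \<Rightarrow> ('b \<times> 'c \<Rightarrow>\<^sub>0 int) set \<Rightarrow> ('b \<times> 'c \<Rightarrow>\<^sub>0 int) set" where
  "tensor_map G s H t f g Z =
     set_mult (free_Abelian_group (carrier G \<times> carrier H))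
       (tensor_rels G s H t) (frag_extend (\<lambda>(a, b). frag_of (f a, g b)) ` Z)"

section \<open>The modules in the theorem\<close>

text \<open>\<open>W\<close> acts trivially on \<open>D(Cat)\<^sup>W\<close> and on \<open>Hom\<^sub>W(V, Q)\<close>: both consist of invariants.\<close>

definition D_Cat_W_group ::
    "(complex ^ 'n) set \<Rightarrow> (complex ^ 'n \<Rightarrow> nat) \<Rightarrow> ('n::finite pol \<Rightarrow> 'n pol) monoid" where
  "D_Cat_W_group R m = \<lparr>carrier = D_Cat_W R m, monoid.mult = (\<lambda>L L' p. L p + L' p), one = (\<lambda>p. 0)\<rparr>"

definition scale_fun :: "'n pol \<Rightarrow> ('b \<Rightarrow> 'n pol) \<Rightarrow> 'b \<Rightarrow> 'n pol" where
  "scale_fun f L = (\<lambda>p. f * L p)"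

definition D_Cat_W_module :: "(complex ^ 'n) set \<Rightarrow> (complex ^ 'n \<Rightarrow> nat) \<Rightarrow>
    ('n::finite pol, complex ^ 'n \<Rightarrow> complex ^ 'n, 'n pol \<Rightarrow> 'n pol) gmodule" where
  "D_Cat_W_module R m =
     monoid.extend (D_Cat_W_group R m) (gmodule.fields scale_fun (\<lambda>w L. L))"

definition Q_tr_V :: "(complex ^ 'n) set \<Rightarrow> (complex ^ 'n \<Rightarrow> nat) \<Rightarrow> 'n::finite pol set" where
  "Q_tr_V R m = isotypic_V (weyl_group R) (Q_tr R m)"

definition Hom_V_Q_module :: "(complex ^ 'n) set \<Rightarrow> (complex ^ 'n \<Rightarrow> nat) \<Rightarrow>
    ('n::finite pol, complex ^ 'n \<Rightarrow> complex ^ 'n, complex ^ 'n \<Rightarrow> 'n pol) gmodule" where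
  "Hom_V_Q_module R m =
     \<lparr>carrier = Hom_W (weyl_group R) (Q_tr_V R m), monoid.mult = (\<lambda>\<phi> \<psi> v. \<phi> v + \<psi> v), one = (\<lambda>v. 0),
      scale = scale_fun, gact = (\<lambda>w \<phi>. \<phi>)\<rparr>"

definition Q_tr_V_module :: "(complex ^ 'n) set \<Rightarrow> (complex ^ 'n \<Rightarrow> nat) \<Rightarrow>
    ('n::finite pol, complex ^ 'n \<Rightarrow> complex ^ 'n, 'n pol) gmodule" where
  "Q_tr_V_module R m =
     \<lparr>carrier = Q_tr_V R m, monoid.mult = (+), one = 0, scale = (*), gact = act\<rparr>"

definition V_group :: "(complex ^ 'n) monoid" where
  "V_group = \<lparr>carrier = UNIV, monoid.mult = (+), one = 0\<rparr>"

text \<open>\<open>D(Cat)\<^sup>W \<otimes> V\<close>: invariant polynomials act on the first factor and \<open>W\<close> on the second.\<close>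

definition D_Cat_W_tensor_V_module :: "(complex ^ 'n) set \<Rightarrow> (complex ^ 'n \<Rightarrow> nat) \<Rightarrow>
    ('n::finite pol, complex ^ 'n \<Rightarrow> complex ^ 'n,
     (('n pol \<Rightarrow> 'n pol) \<times> (complex ^ 'n) \<Rightarrow>\<^sub>0 int) set) gmodule" where
  "D_Cat_W_tensor_V_module R m =
    (let G = D_Cat_W_group R m; s = (\<lambda>c. scale_fun (Const c)) in
     monoid.extend (tensor G s V_group (*s))
       (gmodule.fields
         (\<lambda>f. tensor_map G s V_group (*s) (scale_fun f) id)
         (\<lambda>w. tensor_map G s V_group (*s) id w)))"

section \<open>The action by substitution is \<open>(w f)(x) = f(w\<^sup>-\<^sup>1 x)\<close>\<close>

lemma eval_superset:
  assumes "finite S" "Poly_Mapping.keys p \<subseteq> S"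
  shows "eval p x = (\<Sum>t\<in>S. Poly_Mapping.lookup p t * (\<Prod>i\<in>UNIV. x $ i ^ Poly_Mapping.lookup t i))"
  unfolding eval_def using assms
  by (intro sum.mono_neutral_left) (auto simp: in_keys_iff)

lemma eval_add: "eval (p + q) x = eval p x + eval q x"
proof -
  let ?S = "Poly_Mapping.keys p \<union> Poly_Mapping.keys q"
  have "eval (p + q) x = (\<Sum>t\<in>?S. Poly_Mapping.lookup (p + q) t * (\<Prod>i\<in>UNIV. x $ i ^ Poly_Mapping.lookup t i))"
    by (rule eval_superset) (auto simp: keys_add)
  also have "\<dots> = eval p x + eval q x"
    by (subst (1 2) eval_superset[where S = ?S])
       (auto simp: lookup_add sum.distrib algebra_simps)
  finally show ?thesis .
qed

lemma eval_zero [simp]: "eval 0 x = 0"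
  by (simp add: eval_def)

lemma eval_single:
  "eval (Poly_Mapping.single t c) x = c * (\<Prod>i\<in>UNIV. x $ i ^ Poly_Mapping.lookup t i)"
  by (cases "c = 0") (simp_all add: eval_def)

lemma eval_sum: "eval (sum f A) x = (\<Sum>a\<in>A. eval (f a) x)"
  by (induction A rule: infinite_finite_induct) (auto simp: eval_add)

lemma eval_single_mult:
  "eval (Poly_Mapping.single s a * Poly_Mapping.single t b) x =
   eval (Poly_Mapping.single s a) x * eval (Poly_Mapping.single t b) x"
  by (simp add: mult_single eval_single lookup_add power_add prod.distrib)

lemma poly_sum_single: "(p :: 'n pol) = (\<Sum>t\<in>Poly_Mapping.keys p. Poly_Mapping.single t (Poly_Mapping.lookup p t))"
  by (rule poly_mapping_eqI) (auto simp: lookup_sum lookup_single when_def in_keys_iff)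

lemma eval_mult: "eval (p * q) x = eval p x * eval q x"
proof -
  have "p * q = (\<Sum>s\<in>Poly_Mapping.keys p. \<Sum>t\<in>Poly_Mapping.keys q.
      Poly_Mapping.single s (Poly_Mapping.lookup p s) * Poly_Mapping.single t (Poly_Mapping.lookup q t))"
    by (subst poly_sum_single[of p], subst poly_sum_single[of q]) (simp add: sum_product)
  hence "eval (p * q) x = (\<Sum>s\<in>Poly_Mapping.keys p. \<Sum>t\<in>Poly_Mapping.keys q.
      eval (Poly_Mapping.single s (Poly_Mapping.lookup p s)) x *
      eval (Poly_Mapping.single t (Poly_Mapping.lookup q t)) x)"
    by (simp add: eval_sum eval_single_mult)
  also have "\<dots> = eval p x * eval q x"
    by (subst (3) poly_sum_single[of p], subst (3) poly_sum_single[of q])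
       (simp only: eval_sum sum_product)
  finally show ?thesis .
qed

lemma eval_Const [simp]: "eval (Const c) x = c"
  by (simp add: Const_def eval_single)

lemma eval_one [simp]: "eval 1 x = 1"
  using eval_Const[of 1 x] by (simp add: Const_def)

lemma eval_Var [simp]: "eval (Var i) x = x $ i"
proof -
  have "(\<Prod>k\<in>UNIV. x $ k ^ Poly_Mapping.lookup (Poly_Mapping.single i (1::nat)) k) =
        (\<Prod>k\<in>UNIV. if k = i then x $ i else 1)"
    by (intro prod.cong) (auto simp: lookup_single when_def)
  thus ?thesis by (simp add: Var_def eval_single)
qed

lemma eval_power: "eval (p ^ k) x = eval p x ^ k"
  by (induction k) (auto simp: eval_mult)

lemma eval_prod: "eval (prod f A) x = (\<Prod>a\<in>A. eval (f a) x)"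
  by (induction A rule: infinite_finite_induct) (auto simp: eval_mult)

lemma eval_linear_form [simp]: "eval (linear_form v) x = scalar_product v x"
  by (simp add: linear_form_def eval_sum eval_mult scalar_product_def)

lemma eval_act:
  assumes "Vector_Spaces.linear (*s) (*s) (inv w)"
  shows "eval (act w f) x = eval f (inv w x)"
proof -
  have "scalar_product (row i (matrix (inv w))) x = inv w x $ i" for i
    using matrix_works[OF assms, of x]
    by (simp add: scalar_product_def row_def matrix_vector_mult_def vec_eq_iff)
  thus ?thesis
    by (simp add: act_def eval_sum eval_mult eval_prod eval_power) (simp add: eval_def)
qed

lemma scalar_product_self_nonzero:
  assumes "root_system R" "\<alpha> \<in> R"
  shows "scalar_product \<alpha> \<alpha> \<noteq> 0"
proof
  assume *: "scalar_product \<alpha> \<alpha> = 0"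
  have re: "\<alpha> $ i = complex_of_real (Re (\<alpha> $ i))" for i
    using assms by (auto simp: root_system_def elim!: Reals_cases)
  have "scalar_product \<alpha> \<alpha> = (\<Sum>i\<in>UNIV. complex_of_real ((Re (\<alpha> $ i))\<^sup>2))"
    unfolding scalar_product_def
    by (intro sum.cong refl) (metis re of_real_mult power2_eq_square)
  hence "scalar_product \<alpha> \<alpha> = complex_of_real (\<Sum>i\<in>UNIV. (Re (\<alpha> $ i))\<^sup>2)"
    by simp
  with * have "(\<Sum>i\<in>UNIV. (Re (\<alpha> $ i))\<^sup>2) = 0"
    by (metis of_real_eq_0_iff)
  hence "\<forall>i. Re (\<alpha> $ i) = 0"
    by (simp add: sum_nonneg_eq_0_iff)
  hence "\<alpha> = 0"
    by (metis re of_real_0 vec_eq_iff zero_index)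
  with assms show False
    by (auto simp: root_system_def)
qed

lemma reflection_linear: "Vector_Spaces.linear (*s) (*s) (reflection \<alpha>)"
  by unfold_locales
     (simp_all add: reflection_def scalar_product_def vec_eq_iff algebra_simps sum.distrib
        sum_distrib_left)

lemma reflection_involution:
  assumes "scalar_product \<alpha> \<alpha> \<noteq> 0"
  shows "reflection \<alpha> (reflection \<alpha> x) = x"
proof -
  have "scalar_product \<alpha> (x - c *s \<alpha>) = scalar_product \<alpha> x - c * scalar_product \<alpha> \<alpha>" for c
    by (simp add: scalar_product_def algebra_simps sum_subtractf sum_distrib_left)
  thus ?thesis using assms
    by (simp add: reflection_def coroot_def vec_eq_iff)
qed

lemma weyl_group_subgroup:
  assumes "root_system R"
  shows "subgroup (weyl_group R) (BijGroup UNIV)"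
proof -
  have "reflection ` R \<subseteq> carrier (BijGroup UNIV)"
    using reflection_involution[OF scalar_product_self_nonzero[OF assms]]
    by (auto simp: BijGroup_def Bij_def intro!: o_bij simp: fun_eq_iff)
  thus ?thesis
    unfolding weyl_group_def by (intro group.generate_is_subgroup group_BijGroup)
qed

lemma weyl_group_properties:
  assumes "root_system R" "w \<in> weyl_group R"
  shows "bij w" "Vector_Spaces.linear (*s) (*s) w" "Vector_Spaces.linear (*s) (*s) (inv w)"
    "inv w \<in> weyl_group R"
proof -
  have carr: "bij v" if "v \<in> weyl_group R" for v
    using subgroup.mem_carrier[OF weyl_group_subgroup[OF assms(1)] that]
    by (simp add: BijGroup_def Bij_def)
  have inv: "m_inv (BijGroup UNIV) v = inv v" if "bij v" for v :: "complex ^ 'a \<Rightarrow> complex ^ 'a"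
    using that by (subst inv_BijGroup) (auto simp: Bij_def)
  show bij: "bij w"
    by (rule carr) fact
  show "inv w \<in> weyl_group R"
    using subgroup.m_inv_closed[OF weyl_group_subgroup[OF assms(1)] assms(2)] inv[OF bij] by simp
  show lin: "Vector_Spaces.linear (*s) (*s) w"
    using assms(2) unfolding weyl_group_def
  proof (induction rule: generate.induct)
    case one
    show ?case by (simp add: BijGroup_def vec.linear_id[unfolded id_def])
  next
    case (incl h)
    thus ?case by (auto intro: reflection_linear)
  next
    case (inv h)
    then obtain \<alpha> where h: "\<alpha> \<in> R" "h = reflection \<alpha>" by auto
    have "h \<circ> h = id"
      using reflection_involution[OF scalar_product_self_nonzero[OF assms(1) h(1)]] h
      by (auto simp: fun_eq_iff)
    hence "bij h" "inv_into UNIV h = h"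
      by (auto intro: o_bij inv_unique_comp)
    moreover have "m_inv (BijGroup UNIV) h = inv_into UNIV h"
      using \<open>bij h\<close> by (subst inv_BijGroup) (auto simp: Bij_def)
    ultimately show ?case
      using h reflection_linear by simp
  next
    case (eng g h)
    have "g \<in> weyl_group R" "h \<in> weyl_group R"
      using eng by (auto simp: weyl_group_def)
    hence "bij g" "bij h" by (auto intro: carr)
    hence "g \<otimes>\<^bsub>BijGroup UNIV\<^esub> h = g \<circ> h"
      by (auto simp: BijGroup_def Bij_def compose_def)
    thus ?case
      using Vector_Spaces.linear_compose[OF eng.IH(2,1)] by (simp add: o_def)
  qed
  show "Vector_Spaces.linear (*s) (*s) (inv w)"
    using lin bij by (intro vec.inj_linear_imp_inv_linear) (auto dest: bij_is_inj)
qed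

corollary eval_act_weyl:
  assumes "root_system R" "w \<in> weyl_group R"
  shows "eval (act w f) x = eval f (inv w x)"
  by (intro eval_act weyl_group_properties[OF assms])

end

theory Submission
  imports Defs
begin

text \<open>
  A \<open>W\<close>-invariant derivation \<open>L\<close> amounts to the equivariant map \<open>\<phi> v = L (v, _)\<close>. Let \<open>(\<alpha>, y) = j\<close>, so that
  \<open>y = x + j/2 \<alpha>\<^sup>\<or>\<close> and \<open>s\<^sub>\<alpha> y = x - j/2 \<alpha>\<^sup>\<or>\<close> with \<open>(\<alpha>, x) = 0\<close>. By equivariance
  \<open>\<phi> v (s\<^sub>\<alpha> y) = \<phi> v y - (\<alpha>, v) \<phi> \<alpha>\<^sup>\<or> y\<close>, so all values of \<open>\<phi>\<close> are quasi-invariant iff \<open>\<phi> \<alpha>\<close> vanishes on the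
  hyperplanes \<open>(\<alpha>, y) = j\<close>, which is divisibility of \<open>L (\<alpha>, _)\<close> by \<open>(\<alpha>, _) - j\<close>. The second isomorphism is
  evaluation \<open>L \<otimes> v \<mapsto> \<phi> v\<close>; the relations defining the tensor product are exactly the kernel of evaluation
  on the free abelian group.
\<close>

section \<open>Polynomials as functions\<close>

text \<open>Induction that eliminates one monomial \<open>t\<close>: every other exponent differs
  from \<open>t\<close> in some coordinate \<open>k\<close>, and stretching that coordinate tells
  the two apart. This makes \<open>eval\<close> injective.\<close>

lemma monomial_functions_independent:
  assumes "finite S" and "\<And>x :: complex ^ 'n. (\<Sum>t\<in>S. c t * (\<Prod>i\<in>UNIV. x $ i ^ Poly_Mapping.lookup t i)) = 0"
  shows "\<forall>t\<in>S. c t = 0"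
  using assms
proof (induction S arbitrary: c rule: finite_induct)
  case empty
  show ?case by simp
next
  case (insert t S)
  let ?mon = "\<lambda>s x. \<Prod>i\<in>UNIV. (x :: complex ^ 'n) $ i ^ Poly_Mapping.lookup s i"
  have c0: "c s = 0" if "s \<in> S" for s
  proof -
    from that insert.hyps have "s \<noteq> t" by auto
    then obtain k where k: "Poly_Mapping.lookup s k \<noteq> Poly_Mapping.lookup t k"
      by (auto simp: poly_mapping_eq_iff fun_eq_iff)
    define d where "d s = c s * (2 ^ Poly_Mapping.lookup s k - 2 ^ Poly_Mapping.lookup t k)" for s
    \<comment> \<open>Comparing the relation at \<open>x\<close> with the one at \<open>x\<close> stretched by \<open>2\<close> along \<open>k\<close> eliminates \<open>t\<close>.\<close>
    have "(\<Sum>s\<in>S. d s * ?mon s x) = 0" for x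
    proof -
      define y where "y = (\<chi> i. if i = k then 2 * x $ i else x $ i)"
      have y: "?mon s y = 2 ^ Poly_Mapping.lookup s k * ?mon s x" for s
      proof -
        have "?mon s y = (\<Prod>i\<in>UNIV. (if i = k then 2 ^ Poly_Mapping.lookup s k else 1) * x $ i ^ Poly_Mapping.lookup s i)"
          by (intro prod.cong) (auto simp: y_def power_mult_distrib)
        thus ?thesis by (simp add: prod.distrib)
      qed
      have "(\<Sum>s\<in>insert t S. d s * ?mon s x) =
            (\<Sum>s\<in>insert t S. c s * ?mon s y) - 2 ^ Poly_Mapping.lookup t k * (\<Sum>s\<in>insert t S. c s * ?mon s x)"
        unfolding y d_def sum_distrib_left sum_subtractf[symmetric]
        by (intro sum.cong) (auto simp: algebra_simps)
      also have "\<dots> = 0" using insert.prems by simp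
      finally show ?thesis using insert.hyps by (simp add: d_def)
    qed
    from insert.IH[OF this] that have "d s = 0" by blast
    moreover have "(2::complex) ^ Poly_Mapping.lookup s k \<noteq> 2 ^ Poly_Mapping.lookup t k"
    proof
      assume "(2::complex) ^ Poly_Mapping.lookup s k = 2 ^ Poly_Mapping.lookup t k"
      hence "norm ((2::complex) ^ Poly_Mapping.lookup s k) = norm ((2::complex) ^ Poly_Mapping.lookup t k)"
        by simp
      thus False using k by (simp add: norm_power)
    qed
    ultimately show ?thesis by (simp add: d_def)
  qed
  \<comment> \<open>At the all-ones vector every monomial equals 1, so only \<open>c t\<close> is
    left of the relation.\<close>
  have "c t = 0"
    using insert.prems[of "\<chi> i. 1"] insert.hyps c0 by simp
  with c0 show ?case by auto
qed

lemma eval_uminus: "eval (- p) x = - eval p x"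
  using eval_add[of p "- p" x] by (simp add: eq_neg_iff_add_eq_0 add.commute)

lemma eval_diff: "eval (p - q) x = eval p x - eval q x"
  using eval_add[of p "- q" x] by (simp add: eval_uminus)

lemmas eval_simps = eval_add eval_diff eval_uminus eval_mult eval_sum eval_prod eval_power

text \<open>A difference whose values all vanish has zero coefficients by
  \<open>monomial_functions_independent\<close>. The vector space axioms and the laws of
  \<open>act\<close> are verified on values in this way.\<close>

lemma pol_eqI:
  fixes p q :: "'n::finite pol"
  assumes "\<And>x. eval p x = eval q x"
  shows "p = q"
proof -
  have "\<forall>t\<in>Poly_Mapping.keys (p - q). Poly_Mapping.lookup (p - q) t = 0"
    using assms by (intro monomial_functions_independent) (simp_all flip: eval_def add: eval_diff)
  hence "p - q = 0" by (auto simp: in_keys_iff poly_mapping_eq_iff fun_eq_iff)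
  thus ?thesis by simp
qed

text \<open>Constants and variables generate the polynomial ring: \<open>p\<close> is expanded into
  monomials, and \<open>P\<close> is carried through powers, products and sums.\<close>

lemma pol_induct [case_names Const Var add mult]:
  fixes p :: "'n::finite pol"
  assumes "\<And>c. P (Const c)" "\<And>i. P (Var i)"
    and add: "\<And>p q. P p \<Longrightarrow> P q \<Longrightarrow> P (p + q)" and mult: "\<And>p q. P p \<Longrightarrow> P q \<Longrightarrow> P (p * q)"
  shows "P p"
proof -
  have one: "P 1" using assms(1)[of 1] by (simp add: Const_def)
  have zero: "P 0" using assms(1)[of 0] by (simp add: Const_def)
  have power: "P (q ^ k)" if "P q" for q k
    using that by (induction k) (auto intro: one mult)
  have prod: "P (prod f A)" if "\<And>a. P (f a)" for f and A :: "'n set"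
    using that by (induction A rule: infinite_finite_induct) (auto intro: one mult)
  have sum: "P (sum f A)" if "\<And>a. P (f a)" for f and A :: "('n \<Rightarrow>\<^sub>0 nat) set"
    using that by (induction A rule: infinite_finite_induct) (auto intro: zero add)
  have "p = (\<Sum>t\<in>Poly_Mapping.keys p. Const (Poly_Mapping.lookup p t) * (\<Prod>i\<in>UNIV. Var i ^ Poly_Mapping.lookup t i))"
    by (rule pol_eqI) (simp add: eval_simps, simp add: eval_def)
  also have "P \<dots>"
    by (intro sum mult prod power assms(1,2))
  finally show ?thesis .
qed

lemma eval_cscale [simp]: "eval (cscale c p) x = c * eval p x"
  by (simp add: cscale_def eval_mult)

interpretation pol: vector_space "cscale :: complex \<Rightarrow> 'n::finite pol \<Rightarrow> 'n pol"
  by unfold_locales (auto intro!: pol_eqI simp: eval_simps algebra_simps)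

section \<open>The bilinear form, linear forms and their hyperplanes\<close>

lemma scalar_product_commute: "scalar_product (x :: complex ^ 'n) y = scalar_product y x"
  by (simp add: scalar_product_def mult.commute)

lemma scalar_product_add:
  fixes x y z :: "complex ^ 'n"
  shows
  "scalar_product (x + y) z = scalar_product x z + scalar_product y z"
  "scalar_product z (x + y) = scalar_product z x + scalar_product z y"
  by (simp_all add: scalar_product_def algebra_simps sum.distrib)

lemma scalar_product_diff:
  fixes x y z :: "complex ^ 'n"
  shows "scalar_product (x - y) z = scalar_product x z - scalar_product y z"
    "scalar_product z (x - y) = scalar_product z x - scalar_product z y"
  by (simp_all add: scalar_product_def algebra_simps sum_subtractf)

lemma scalar_product_scale:
  fixes x z :: "complex ^ 'n"
  shows
  "scalar_product (c *s x) z = c * scalar_product x z"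
  "scalar_product z (c *s x) = c * scalar_product z x"
  by (simp_all add: scalar_product_def algebra_simps sum_distrib_left)

lemma scalar_product_axis: "scalar_product (axis i 1) (x :: complex ^ 'n) = x $ i"
proof -
  have "(\<Sum>k\<in>UNIV. axis i 1 $ k * x $ k) = (\<Sum>k\<in>UNIV. if k = i then x $ k else 0)"
    by (intro sum.cong) (auto simp: axis_def)
  thus ?thesis by (simp add: scalar_product_def)
qed

lemma scalar_product_eqI:
  fixes x y :: "complex ^ 'n"
  assumes "\<And>z. scalar_product z x = scalar_product z y"
  shows "x = y"
  using assms[of "axis _ 1"] by (simp add: vec_eq_iff scalar_product_axis)

lemma linear_form_add: "linear_form (v + w) = linear_form v + linear_form w"
  by (rule pol_eqI) (simp add: eval_simps scalar_product_add)

lemma linear_form_scale: "linear_form (c *s v) = cscale c (linear_form v)"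
  by (rule pol_eqI) (simp add: scalar_product_scale)

lemma linear_form_axis: "linear_form (axis i 1) = Var i"
  by (rule pol_eqI) (simp add: scalar_product_axis)

text \<open>Here \<open>q\<close> is \<open>p\<close> with \<open>x_k\<close> replaced by
  \<open>g\<close>, described by its values. Congruences modulo \<open>Var k - g\<close> respect
  sums and products, so constants and variables suffice.\<close>

lemma substitution_congruent:
  fixes p :: "'n::finite pol"
  shows "\<exists>q. (Var k - g) dvd (p - q) \<and> (\<forall>x. eval q x = eval p (\<chi> i. if i = k then eval g x else x $ i))"
proof (induction p rule: pol_induct)
  case (Const c)
  show ?case by (intro exI[of _ "Const c"]) simp
next
  case (Var i)
  show ?case by (intro exI[of _ "if i = k then g else Var i"]) simp
next
  case (add p q)
  then obtain p' q' where
    "(Var k - g) dvd (p - p')" "\<forall>x. eval p' x = eval p (\<chi> i. if i = k then eval g x else x $ i)"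
    "(Var k - g) dvd (q - q')" "\<forall>x. eval q' x = eval q (\<chi> i. if i = k then eval g x else x $ i)"
    by blast
  thus ?case
    by (intro exI[of _ "p' + q'"]) (auto simp: eval_simps add_diff_add)
next
  case (mult p q)
  then obtain p' q' where
    *: "(Var k - g) dvd (p - p')" "\<forall>x. eval p' x = eval p (\<chi> i. if i = k then eval g x else x $ i)"
    "(Var k - g) dvd (q - q')" "\<forall>x. eval q' x = eval q (\<chi> i. if i = k then eval g x else x $ i)"
    by blast
  have "p * q - p' * q' = (p - p') * q + p' * (q - q')"
    by (simp add: algebra_simps)
  with * have "(Var k - g) dvd (p * q - p' * q')" by simp
  with * show ?case
    by (intro exI[of _ "p' * q'"]) (auto simp: eval_simps)
qed

lemma vanishing_on_hyperplane_dvd: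
  fixes p :: "'n::finite pol"
  assumes "v \<noteq> 0" and van: "\<And>x. scalar_product v x = c \<Longrightarrow> eval p x = 0"
  shows "(linear_form v - Const c) dvd p"
proof -
  from assms obtain k where k: "v $ k \<noteq> 0" by (auto simp: vec_eq_iff)
  \<comment> \<open>The hyperplane equation solved for \<open>x_k\<close> reads
    \<open>x_k = g\<close>; hence \<open>Var k - g\<close> is the wanted divisor up to the nonzero
    constant \<open>v $ k\<close>.\<close>
  define g where "g = Var k - Const (1 / v $ k) * (linear_form v - Const c)"
  from substitution_congruent[of k g p] obtain q where
    q: "(Var k - g) dvd (p - q)" "\<And>x. eval q x = eval p (\<chi> i. if i = k then eval g x else x $ i)"
    by blast
  \<comment> \<open>Substituting \<open>g\<close> moves every point onto the hyperplane, where
    \<open>p\<close> vanishes.\<close>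
  have "q = 0"
  proof (rule pol_eqI)
    fix x :: "complex ^ 'n"
    define y where "y = (\<chi> i. if i = k then eval g x else x $ i)"
    have y: "y = x + (eval g x - x $ k) *s axis k 1"
      by (auto simp: y_def vec_eq_iff axis_def)
    have "scalar_product v y = scalar_product v x + (eval g x - x $ k) * scalar_product v (axis k 1)"
      by (simp only: y scalar_product_add scalar_product_scale)
    also have "scalar_product v (axis k 1) = v $ k"
      using scalar_product_axis[of k v] by (simp add: scalar_product_commute)
    also have "scalar_product v x + (eval g x - x $ k) * v $ k = c"
      using k by (simp add: g_def eval_simps field_simps)
    finally show "eval q x = eval 0 x"
      using van q(2)[of x] by (simp add: y_def)
  qed
  moreover have "linear_form v - Const c = Const (v $ k) * (Var k - g)"
    using k by (intro pol_eqI) (simp add: g_def eval_simps)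
  moreover have "p = Const (1 / v $ k) * (Const (v $ k) * p)"
    using k by (intro pol_eqI) (simp add: eval_simps)
  ultimately show ?thesis
    using q(1) by (metis diff_zero dvd_mult mult_dvd_mono dvd_refl)
qed

section \<open>Derivations\<close>

lemma partial_derivative_exists:
  fixes p :: "'n::finite pol"
  shows "\<exists>d. \<forall>x. ((\<lambda>z. eval p (x + z *s axis i 1)) has_field_derivative eval d x) (at 0)"
proof (induction p rule: pol_induct)
  case (Const c)
  show ?case by (intro exI[of _ 0]) simp
next
  case (Var k)
  show ?case
    by (intro exI[of _ "Const (axis i 1 $ k)"]) (auto intro!: derivative_eq_intros)
next
  case (add p q)
  then obtain d e where 
    "\<forall>x. ((\<lambda>z. eval p (x + z *s axis i 1)) has_field_derivative eval d x) (at 0)"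
    "\<forall>x. ((\<lambda>z. eval q (x + z *s axis i 1)) has_field_derivative eval e x) (at 0)"
    by blast
  thus ?case by (intro exI[of _ "d + e"]) (auto simp: eval_simps intro!: derivative_eq_intros)
next
  case (mult p q)
  then obtain d e where 
    "\<forall>x. ((\<lambda>z. eval p (x + z *s axis i 1)) has_field_derivative eval d x) (at 0)"
    "\<forall>x. ((\<lambda>z. eval q (x + z *s axis i 1)) has_field_derivative eval e x) (at 0)"
    by blast
  thus ?case
    by (intro exI[of _ "d * q + p * e"]) (auto simp: eval_simps intro!: derivative_eq_intros)
qed

text \<open>The formal partial derivative, obtained analytically. Complex derivatives are unique, so
  the choice is determined and the algebraic laws follow from derivative rules applied to
  values.\<close>

definition partial_derivative :: "'n \<Rightarrow> 'n::finite pol \<Rightarrow> 'n pol" where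
  "partial_derivative i p =
     (SOME d. \<forall>x. ((\<lambda>z. eval p (x + z *s axis i 1)) has_field_derivative eval d x) (at 0))"

lemma has_partial_derivative:
  "((\<lambda>z. eval p (x + z *s axis i 1)) has_field_derivative eval (partial_derivative i p) x) (at 0)"
  using someI_ex[OF partial_derivative_exists[of p i]] by (simp add: partial_derivative_def)

lemma partial_derivative_eqI:
  assumes "\<And>x. ((\<lambda>z. eval p (x + z *s axis i 1)) has_field_derivative eval d x) (at 0)"
  shows "partial_derivative i p = d"
  by (intro pol_eqI DERIV_unique[OF has_partial_derivative] assms)

lemma partial_derivative_add:
  "partial_derivative i (p + q) = partial_derivative i p + partial_derivative i q"
  by (rule partial_derivative_eqI)
     (auto simp: eval_simps intro!: derivative_eq_intros has_partial_derivative)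

lemma partial_derivative_mult:
  "partial_derivative i (p * q) = partial_derivative i p * q + p * partial_derivative i q"
  by (rule partial_derivative_eqI)
     (auto simp: eval_simps intro!: derivative_eq_intros has_partial_derivative)

lemma partial_derivative_cscale: "partial_derivative i (cscale c p) = cscale c (partial_derivative i p)"
  by (rule partial_derivative_eqI)
     (auto simp: eval_simps intro!: derivative_eq_intros has_partial_derivative)

lemma partial_derivative_linear_form: "partial_derivative i (linear_form v) = Const (v $ i)"
proof (rule partial_derivative_eqI)
  fix x :: "complex ^ 'a"
  have "eval (linear_form v) (x + z *s axis i 1) = scalar_product v x + z * scalar_product (axis i 1) v" for z
    by (simp add: scalar_product_add scalar_product_scale scalar_product_commute)
  thus "((\<lambda>z. eval (linear_form v) (x + z *s axis i 1)) has_field_derivative eval (Const (v $ i)) x) (at 0)"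
    by (auto simp: scalar_product_axis intro!: derivative_eq_intros)
qed

section \<open>Derivations and their values on linear forms\<close>

lemma linear_cscale_iff:
  fixes L :: "'n::finite pol \<Rightarrow> 'n pol"
  shows "Vector_Spaces.linear cscale cscale L \<longleftrightarrow>
    (\<forall>p q. L (p + q) = L p + L q) \<and> (\<forall>c p. L (cscale c p) = cscale c (L p))"
  by (simp add: Vector_Spaces.linear_iff pol.vector_space_axioms)

text \<open>This supplies a derivation with prescribed values \<open>f i\<close> on the
  coordinates.\<close>

lemma Der_sum_partial_derivative:
  fixes f :: "'n::finite \<Rightarrow> 'n pol"
  shows "(\<lambda>p. \<Sum>i\<in>UNIV. f i * partial_derivative i p) \<in> Der"
  by (simp add: Der_def linear_cscale_iff partial_derivative_add partial_derivative_mult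
      partial_derivative_cscale algebra_simps sum.distrib sum_distrib_left sum_distrib_right)
     (simp add: cscale_def algebra_simps sum_distrib_left)

lemma Der_Const:
  assumes "L \<in> Der"
  shows "L (Const c) = 0"
proof -
  have "L (1 * 1) = L 1 * 1 + 1 * L 1"
    using assms unfolding Der_def by blast
  hence "L 1 = 0" by simp
  moreover have "L (cscale c 1) = cscale c (L 1)"
    using assms by (simp add: Der_def linear_cscale_iff)
  ultimately show ?thesis by (simp add: cscale_def)
qed

text \<open>A derivation kills constants, and the Leibniz rule propagates its values from the
  coordinates, which are the linear forms of the basis vectors.\<close>

lemma Der_eqI:
  fixes L :: "'n::finite pol \<Rightarrow> 'n pol"
  assumes "L \<in> Der" "M \<in> Der" "\<And>v. L (linear_form v) = M (linear_form v)"
  shows "L = M"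
proof
  fix p show "L p = M p"
  proof (induction p rule: pol_induct)
    case (Var i)
    show ?case using assms(3)[of "axis i 1"] by (simp add: linear_form_axis)
  next
    case (Const c)
    show ?case using assms by (simp add: Der_Const)
  qed (use assms in \<open>auto simp: Der_def linear_cscale_iff\<close>)
qed

lemma Der_linear_form_linear:
  assumes "L \<in> Der"
  shows "Vector_Spaces.linear (*s) cscale (\<lambda>v. L (linear_form v))"
  using assms
  by (simp add: Vector_Spaces.linear_iff vec.vector_space_axioms pol.vector_space_axioms Der_def
      linear_form_add linear_form_scale)


section \<open>The Weyl group\<close>

lemma weyl_group_incl: "\<alpha> \<in> R \<Longrightarrow> reflection \<alpha> \<in> weyl_group R"
  unfolding weyl_group_def by (intro generate.incl) simp

lemma scalar_product_coroot:
  assumes "scalar_product \<alpha> \<alpha> \<noteq> 0"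
  shows "scalar_product \<alpha> (coroot \<alpha>) = 2"
  using assms by (simp add: coroot_def scalar_product_scale)

lemma reflection_orthogonal:
  assumes "scalar_product \<alpha> \<alpha> \<noteq> 0"
  shows "scalar_product (reflection \<alpha> x) (reflection \<alpha> y) = scalar_product x y"
  using assms
  by (simp add: reflection_def coroot_def scalar_product_diff scalar_product_scale
      scalar_product_commute[of x \<alpha>] scalar_product_commute[of y \<alpha>] field_simps)

lemma inv_reflection:
  assumes "scalar_product \<alpha> \<alpha> \<noteq> 0"
  shows "inv (reflection \<alpha>) = reflection \<alpha>"
  using reflection_involution[OF assms] by (intro inv_unique_comp) (auto simp: fun_eq_iff)

lemma weyl_group_orthogonal:
  assumes R: "root_system R" and "w \<in> weyl_group R"
  shows "scalar_product (w x) (w y) = scalar_product x y"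
  using assms(2) unfolding weyl_group_def
proof (induction arbitrary: x y rule: generate.induct)
  case one
  show ?case by (simp add: BijGroup_def)
next
  case (incl h)
  thus ?case using scalar_product_self_nonzero[OF R] by (auto simp: reflection_orthogonal)
next
  case (inv h)
  then obtain \<alpha> where h: "\<alpha> \<in> R" "h = reflection \<alpha>" by auto
  note nz = scalar_product_self_nonzero[OF R h(1)]
  have "h \<in> Bij UNIV"
    using weyl_group_properties(1)[OF R weyl_group_incl[OF h(1)]] h(2) by (simp add: Bij_def)
  hence "m_inv (BijGroup UNIV) h = reflection \<alpha>"
    by (simp add: inv_BijGroup h(2) inv_reflection[OF nz] restrict_def)
  thus ?case by (simp add: reflection_orthogonal[OF nz])
next
  case (eng g h)
  have "g \<in> Bij UNIV" "h \<in> Bij UNIV"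
    using eng.hyps weyl_group_properties(1)[OF R] by (simp_all add: weyl_group_def Bij_def)
  hence "g \<otimes>\<^bsub>BijGroup UNIV\<^esub> h = g \<circ> h"
    by (auto simp: BijGroup_def compose_def)
  thus ?case using eng.IH by simp
qed

lemma weyl_group_inv:
  assumes "root_system R" "w \<in> weyl_group R"
  shows "w (inv w x) = x" "inv w (w x) = x" "inv (inv w) = w"
  using weyl_group_properties(1)[OF assms]
  by (simp_all add: bij_inv_eq_iff inv_inv_eq surj_f_inv_f bij_is_surj bij_is_inj)

text \<open>Orthogonality trades \<open>inv w\<close> on the argument for \<open>w\<close> on
  \<open>v\<close>; thus the form identifies \<open>V\<close> with its dual equivariantly.\<close>

lemma act_linear_form:
  assumes "root_system R" "w \<in> weyl_group R"
  shows "act w (linear_form v) = linear_form (w v)"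
proof (rule pol_eqI)
  fix x
  have "scalar_product v (inv w x) = scalar_product (w v) (w (inv w x))"
    using weyl_group_orthogonal[OF assms] by simp
  thus "eval (act w (linear_form v)) x = eval (linear_form (w v)) x"
    by (simp add: eval_act_weyl[OF assms] weyl_group_inv[OF assms])
qed

lemma act_add:
  assumes "root_system R" "w \<in> weyl_group R"
  shows "act w (p + q) = act w p + act w q"
  by (rule pol_eqI) (simp add: eval_act_weyl[OF assms] eval_simps)

lemma act_mult:
  assumes "root_system R" "w \<in> weyl_group R"
  shows "act w (p * q) = act w p * act w q"
  by (rule pol_eqI) (simp add: eval_act_weyl[OF assms] eval_simps)

lemma act_cscale:
  assumes "root_system R" "w \<in> weyl_group R"
  shows "act w (cscale c p) = cscale c (act w p)"
  by (rule pol_eqI) (simp add: eval_act_weyl[OF assms])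

lemma act_inv:
  assumes "root_system R" "w \<in> weyl_group R"
  shows "act w (act (inv w) p) = p" "act (inv w) (act w p) = p"
  using weyl_group_properties(4)[OF assms] weyl_group_inv[OF assms]
  by (auto intro!: pol_eqI simp: eval_act_weyl[OF assms(1)] assms(2))

lemma act_der_Der:
  assumes "root_system R" "w \<in> weyl_group R" "L \<in> Der"
  shows "act_der w L \<in> Der"
proof -
  note w = assms(1,2)
  note w' = assms(1) weyl_group_properties(4)[OF w]
  show ?thesis
    using assms(3) by (auto simp: Der_def linear_cscale_iff act_der_def act_add[OF w] act_add[OF w']
      act_mult[OF w] act_mult[OF w'] act_cscale[OF w] act_cscale[OF w'] act_inv[OF w])
qed

lemma span_roots_linear_eq_0:
  fixes f :: "complex ^ 'n \<Rightarrow> 'n::finite pol"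
  assumes R: "root_system R" and f: "Vector_Spaces.linear (*s) cscale f" and "\<And>\<alpha>. \<alpha> \<in> R \<Longrightarrow> f \<alpha> = 0"
  shows "f v = 0"
proof -
  have "v \<in> vec.span R" using R by (simp add: root_system_def)
  thus ?thesis
  proof (induction rule: vec.span_induct_alt)
    case base
    interpret Vector_Spaces.linear "(*s)" cscale f by (fact f)
    show ?case by (fact zero)
  next
    case (step c x y)
    thus ?case using f assms(3) by (simp add: Vector_Spaces.linear_iff)
  qed
qed


lemma act_zero: "act w 0 = 0"
  by (simp add: act_def)

lemma act_sum:
  assumes "root_system R" "w \<in> weyl_group R"
  shows "act w (sum f A) = (\<Sum>a\<in>A. act w (f a))"
  by (rule pol_eqI) (simp add: eval_act_weyl[OF assms] eval_simps)

section \<open>Equivariant maps from \<open>V\<close> to polynomials\<close>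

lemma W_linearD:
  assumes "W_linear W \<phi>"
  shows "\<phi> (u + v) = \<phi> u + \<phi> v" "\<phi> (c *s v) = cscale c (\<phi> v)" "\<phi> 0 = 0" "\<phi> (u - v) = \<phi> u - \<phi> v"
    "w \<in> W \<Longrightarrow> \<phi> (w v) = act w (\<phi> v)"
proof -
  have lin: "Vector_Spaces.linear (*s) cscale \<phi>" using assms by (simp add: W_linear_def)
  show "\<phi> (u + v) = \<phi> u + \<phi> v" "\<phi> (c *s v) = cscale c (\<phi> v)"
    using lin by (simp_all add: Vector_Spaces.linear_iff)
  interpret Vector_Spaces.linear "(*s)" cscale \<phi> by (fact lin)
  show "\<phi> 0 = 0" "\<phi> (u - v) = \<phi> u - \<phi> v" by (fact zero diff)+
  show "w \<in> W \<Longrightarrow> \<phi> (w v) = act w (\<phi> v)" using assms by (simp add: W_linear_def)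
qed

text \<open>Equivariance expanded by linearity: the effect of \<open>reflection \<alpha>\<close> on
  all values of \<open>\<phi>\<close> is governed by the single polynomial
  \<open>\<phi> (coroot \<alpha>)\<close>.\<close>

lemma W_linear_reflection:
  assumes "W_linear (weyl_group R) \<phi>" "\<alpha> \<in> R"
  shows "act (reflection \<alpha>) (\<phi> x) = \<phi> x - cscale (scalar_product \<alpha> x) (\<phi> (coroot \<alpha>))"
  using W_linearD[OF assms(1)] weyl_group_incl[OF assms(2)]
  by (metis reflection_def)

text \<open>Irreducibility of \<open>V\<close>, derived from that of the root system: every root
  lies in the kernel or is orthogonal to it, which splits \<open>R\<close> orthogonally, so one of
  the two parts is empty.\<close>

lemma W_linear_kernel_trivial:
  assumes R: "root_system R" and irr: "irreducible_roots R" and \<phi>: "W_linear (weyl_group R) \<phi>"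
    and ker: "\<phi> u = 0" "u \<noteq> 0"
  shows "\<phi> v = 0"
proof -
  define A where "A = {\<alpha> \<in> R. \<phi> \<alpha> = 0}"
  define B where "B = {\<alpha> \<in> R. \<forall>x. \<phi> x = 0 \<longrightarrow> scalar_product \<alpha> x = 0}"
  note nz = scalar_product_self_nonzero[OF R]
  \<comment> \<open>If the kernel is not orthogonal to \<open>\<alpha>\<close>, it contains \<open>\<alpha>\<close>, as it is stable under \<open>reflection \<alpha>\<close>.\<close>
  have "\<phi> \<alpha> = 0" if \<alpha>: "\<alpha> \<in> R" and x: "\<phi> x = 0" "scalar_product \<alpha> x \<noteq> 0" for \<alpha> x
  proof -
    have "cscale (scalar_product \<alpha> x) (\<phi> (coroot \<alpha>)) = 0"
      using W_linear_reflection[OF \<phi> \<alpha>, of x] x(1) by (simp add: act_zero)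
    hence "\<phi> (coroot \<alpha>) = 0" using x(2) by simp
    thus ?thesis using nz[OF \<alpha>] by (simp add: coroot_def W_linearD[OF \<phi>])
  qed
  hence "A \<union> B = R" by (auto simp: A_def B_def)
  moreover have "A \<inter> B = {}" using nz by (auto simp: A_def B_def)
  moreover have "\<forall>\<alpha>\<in>A. \<forall>\<beta>\<in>B. scalar_product \<alpha> \<beta> = 0"
    by (auto simp: A_def B_def scalar_product_commute)
  ultimately have "A = {} \<or> B = {}"
    using irr unfolding irreducible_roots_def by blast
  \<comment> \<open>Otherwise all roots, hence all of \<open>V\<close>, would be orthogonal to the
    nonzero vector \<open>u\<close>, against nondegeneracy.\<close>
  moreover have "A \<noteq> {}"
  proof
    assume "A = {}"
    with \<open>A \<union> B = R\<close> have orth: "scalar_product \<alpha> u = 0" if "\<alpha> \<in> R" for \<alpha>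
      using that ker(1) by (auto simp: B_def)
    have "scalar_product z u = scalar_product z 0" for z
    proof -
      have "z \<in> vec.span R" using R by (simp add: root_system_def)
      hence "scalar_product z u = 0"
        by (induction rule: vec.span_induct_alt)
           (auto simp: orth scalar_product_add scalar_product_scale, simp add: scalar_product_def)
      thus ?thesis by (simp add: scalar_product_def)
    qed
    with ker(2) show False using scalar_product_eqI by blast
  qed
  ultimately have "A = R" using \<open>A \<union> B = R\<close> by auto
  show ?thesis
    by (rule span_roots_linear_eq_0[OF R]) (use \<open>A = R\<close> \<phi> in \<open>auto simp: A_def W_linear_def\<close>)
qed

text \<open>Applying \<open>1 - reflection \<alpha>\<close> to \<open>\<Sum>i. \<phi> i (e\<^sub>i) = 0\<close> shows that the equivariant map
  \<open>\<Sum>i. \<alpha>\<^sub>i \<phi> i\<close> kills \<open>coroot \<alpha>\<close>, so it vanishes. As the roots span, this avoids Schur's lemma.\<close>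

lemma W_linear_independent:
  fixes \<phi> :: "'n::finite \<Rightarrow> complex ^ 'n \<Rightarrow> 'n pol"
  assumes R: "root_system R" and irr: "irreducible_roots R"
    and \<phi>: "\<And>i. W_linear (weyl_group R) (\<phi> i)" and sum0: "(\<Sum>i\<in>UNIV. \<phi> i (axis i 1)) = 0"
  shows "\<phi> i v = 0"
proof -
  define \<psi> where "\<psi> u v = (\<Sum>i\<in>UNIV. cscale (u $ i) (\<phi> i v))" for u v
  have \<psi>_W: "W_linear (weyl_group R) (\<psi> u)" for u
    unfolding W_linear_def Vector_Spaces.linear_iff
    using vec.vector_space_axioms pol.vector_space_axioms
    by (auto simp: \<psi>_def W_linearD[OF \<phi>] sum.distrib pol.scale_right_distrib pol.scale_sum_right
        act_sum[OF R] act_cscale[OF R] mult.commute)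
  have \<psi>_lin: "Vector_Spaces.linear (*s) cscale (\<lambda>u. \<psi> u v)"
    unfolding Vector_Spaces.linear_iff using vec.vector_space_axioms pol.vector_space_axioms
    by (auto simp: \<psi>_def sum.distrib pol.scale_left_distrib pol.scale_sum_right)
  have "\<psi> \<alpha> v = 0" if \<alpha>: "\<alpha> \<in> R" for \<alpha>
  proof (rule W_linear_kernel_trivial[OF R irr \<psi>_W])
    have "0 = act (reflection \<alpha>) (\<Sum>i\<in>UNIV. \<phi> i (axis i 1))"
      by (simp add: sum0 act_zero)
    also have "\<dots> = (\<Sum>i\<in>UNIV. \<phi> i (axis i 1) - cscale (\<alpha> $ i) (\<phi> i (coroot \<alpha>)))"
      by (simp add: act_sum[OF R weyl_group_incl[OF \<alpha>]] W_linear_reflection[OF \<phi> \<alpha>]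
          scalar_product_commute[of \<alpha>] scalar_product_axis)
    also have "\<dots> = - \<psi> \<alpha> (coroot \<alpha>)"
      by (simp add: sum_subtractf sum0 \<psi>_def)
    finally show "\<psi> \<alpha> (coroot \<alpha>) = 0" by simp
    show "coroot \<alpha> \<noteq> 0"
      using scalar_product_coroot[OF scalar_product_self_nonzero[OF R \<alpha>]]
      by (auto simp: scalar_product_def)
  qed
  hence "\<psi> (axis i 1) v = 0"
    by (rule span_roots_linear_eq_0[OF R \<psi>_lin])
  moreover have "\<psi> (axis i 1) v = (\<Sum>k\<in>UNIV. if k = i then \<phi> k v else 0)"
    unfolding \<psi>_def by (intro sum.cong) (auto simp: axis_def)
  ultimately show ?thesis by simp
qed

section \<open>Equivariant maps into the quasi-invariants are logarithmic derivations\<close>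

text \<open>Invariance of \<open>L\<close> is read at \<open>linear_form (w v)\<close>, which the
  inner \<open>inv w\<close> of \<open>act_der\<close> carries back to
  \<open>linear_form v\<close>.\<close>

lemma D_Cat_W_W_linear:
  assumes R: "root_system R" and L: "L \<in> D_Cat_W R m"
  shows "W_linear (weyl_group R) (\<lambda>v. L (linear_form v))"
  unfolding W_linear_def
proof (intro conjI ballI allI)
  show "Vector_Spaces.linear (*s) cscale (\<lambda>v. L (linear_form v))"
    using L by (intro Der_linear_form_linear) (simp add: D_Cat_W_def D_Cat_def)
  fix w v assume w: "w \<in> weyl_group R"
  have "L (linear_form (w v)) = act_der w L (linear_form (w v))"
    using L w by (simp add: D_Cat_W_def)
  also have "\<dots> = act w (L (linear_form v))"
    by (simp add: act_der_def act_linear_form[OF R weyl_group_properties(4)[OF R w]]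
        weyl_group_inv[OF R w])
  finally show "L (linear_form (w v)) = act w (L (linear_form v))" .
qed

text \<open>The bridge between the two conditions: the points compared in \<open>Q_tr\<close> are
  mirror images, and the first lies on the hyperplane of level \<open>c\<close>.\<close>

lemma reflection_half_coroot:
  assumes "scalar_product \<alpha> \<alpha> \<noteq> 0" "scalar_product \<alpha> x = 0"
  shows "reflection \<alpha> (x + (c / 2) *s coroot \<alpha>) = x - (c / 2) *s coroot \<alpha>"
    "scalar_product \<alpha> (x + (c / 2) *s coroot \<alpha>) = c"
  using assms
  by (simp_all add: reflection_def scalar_product_add scalar_product_scale scalar_product_coroot
      vec_eq_iff field_simps)

text \<open>Divisibility makes \<open>L (linear_form \<alpha>)\<close> vanish on the hyperplanes, so
  the correction term of \<open>W_linear_reflection\<close> disappears there for every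
  \<open>v\<close>.\<close>

lemma D_Cat_W_quasi_invariant:
  assumes R: "root_system R" and L: "L \<in> D_Cat_W R m"
  shows "L (linear_form v) \<in> Q_tr R m"
  unfolding Q_tr_def
proof (intro CollectI ballI allI impI)
  fix \<alpha> x j assume \<alpha>: "\<alpha> \<in> R" and x: "scalar_product \<alpha> x = 0" and j: "j \<in> {1..m \<alpha>}"
  let ?y = "x + (of_nat j / 2) *s coroot \<alpha>"
  note nz = scalar_product_self_nonzero[OF R \<alpha>]
  have "- int (m \<alpha>) \<le> int j \<and> int j \<le> int (m \<alpha>)" using j by auto
  hence "(linear_form \<alpha> - Const (of_int (int j))) dvd L (linear_form \<alpha>)"
    using L \<alpha> unfolding D_Cat_W_def D_Cat_def by blast
  then obtain q where "L (linear_form \<alpha>) = (linear_form \<alpha> - Const (of_nat j)) * q"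
    by (auto elim: dvdE)
  hence "eval (L (linear_form \<alpha>)) ?y = 0"
    by (simp add: eval_simps reflection_half_coroot(2)[OF nz x])
  hence "eval (L (linear_form (coroot \<alpha>))) ?y = 0"
    by (simp add: coroot_def W_linearD[OF D_Cat_W_W_linear[OF R L]])
  hence "eval (act (reflection \<alpha>) (L (linear_form v))) ?y = eval (L (linear_form v)) ?y"
    by (simp add: W_linear_reflection[OF D_Cat_W_W_linear[OF R L] \<alpha>] eval_simps)
  thus "eval (L (linear_form v)) ?y = eval (L (linear_form v)) (x - (of_nat j / 2) *s coroot \<alpha>)"
    by (simp add: eval_act_weyl[OF R weyl_group_incl[OF \<alpha>]] inv_reflection[OF nz]
        reflection_half_coroot(1)[OF nz x])
qed

text \<open>\<open>Q_tr\<close> speaks of levels from 1 on, the arrangement also of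
  \<open>j \<le> 0\<close>: at level 0 the two points coincide, and a change of sign interchanges
  them.\<close>

lemma quasi_invariant_int:
  assumes "p \<in> Q_tr R m" "\<alpha> \<in> R" "scalar_product \<alpha> x = 0" "- int (m \<alpha>) \<le> j" "j \<le> int (m \<alpha>)"
  shows "eval p (x + (of_int j / 2) *s coroot \<alpha>) = eval p (x - (of_int j / 2) *s coroot \<alpha>)"
proof -
  have nat: "eval p (x + (of_nat k / 2) *s coroot \<alpha>) = eval p (x - (of_nat k / 2) *s coroot \<alpha>)"
    if "k \<le> m \<alpha>" for k
  proof (cases "k = 0")
    case False
    hence "k \<in> {1..m \<alpha>}" using that by simp
    thus ?thesis using assms(1-3) unfolding Q_tr_def by blast
  qed simp
  show ?thesis
  proof (cases j rule: int_cases2)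
    case (nonneg k)
    with assms(5) have "k \<le> m \<alpha>" by simp
    from nat[OF this] show ?thesis by (simp only: nonneg of_int_of_nat_eq)
  next
    case (nonpos k)
    with assms(4) have "k \<le> m \<alpha>" by simp
    moreover have "(of_int j / 2) *s coroot \<alpha> = - ((of_nat k / 2) *s coroot \<alpha>)"
      by (simp add: nonpos)
    ultimately show ?thesis
      using nat[of k] by (simp only: add_uminus_conv_diff diff_minus_eq_add)
  qed
qed

text \<open>At mirror points of a hyperplane, \<open>\<phi> \<alpha>\<close> takes opposite values
  by equivariance and equal values by quasi-invariance. Hence it vanishes there, and divisibility
  follows.\<close>

lemma W_linear_D_Cat_W:
  fixes R :: "(complex ^ 'n) set"
  assumes R: "root_system R" and \<phi>: "W_linear (weyl_group R) \<phi>" and Q: "range \<phi> \<subseteq> Q_tr R m"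
  obtains L where "L \<in> D_Cat_W R m" "\<And>v. L (linear_form v) = \<phi> v"
proof -
  define L where "L p = (\<Sum>i\<in>UNIV. \<phi> (axis i 1) * partial_derivative i p)" for p
  have Der: "L \<in> Der"
    using Der_sum_partial_derivative[of "\<lambda>i. \<phi> (axis i 1)"] by (simp add: L_def[abs_def])
  have L\<phi>: "L (linear_form v) = \<phi> v" for v
  proof -
    interpret Vector_Spaces.linear "(*s)" cscale \<phi> using \<phi> by (simp add: W_linear_def)
    have "\<phi> v = \<phi> (\<Sum>i\<in>UNIV. v $ i *s axis i 1)" by (simp add: basis_expansion)
    also have "\<dots> = (\<Sum>i\<in>UNIV. cscale (v $ i) (\<phi> (axis i 1)))" by (simp add: sum scale)
    finally show ?thesis
      by (simp add: L_def partial_derivative_linear_form cscale_def mult.commute)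
  qed
  have "L \<in> D_Cat R m"
    unfolding D_Cat_def
  proof (intro CollectI conjI ballI allI impI Der)
    fix \<alpha> j assume \<alpha>: "\<alpha> \<in> R" and j: "- int (m \<alpha>) \<le> j \<and> j \<le> int (m \<alpha>)"
    note nz = scalar_product_self_nonzero[OF R \<alpha>]
    show "(linear_form \<alpha> - Const (of_int j)) dvd L (linear_form \<alpha>)"
      unfolding L\<phi>
    proof (rule vanishing_on_hyperplane_dvd)
      show "\<alpha> \<noteq> 0" using nz by (auto simp: scalar_product_def)
      fix y assume y: "scalar_product \<alpha> y = of_int j"
      define x where "x = y - (of_int j / 2) *s coroot \<alpha>"
      have x: "scalar_product \<alpha> x = 0"
        by (simp add: x_def scalar_product_diff scalar_product_scale scalar_product_coroot[OF nz] y)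
      have yx: "y = x + (of_int j / 2) *s coroot \<alpha>" by (simp add: x_def)
      have "reflection \<alpha> \<alpha> = - \<alpha>"
        using nz by (simp add: reflection_def coroot_def vec_eq_iff)
      hence "\<phi> (- \<alpha>) = act (reflection \<alpha>) (\<phi> \<alpha>)"
        using W_linearD(5)[OF \<phi> weyl_group_incl[OF \<alpha>], of \<alpha>] by simp
      moreover have "\<phi> (- \<alpha>) = - \<phi> \<alpha>"
        using W_linearD(4)[OF \<phi>, of 0 \<alpha>] by (simp add: W_linearD(3)[OF \<phi>])
      ultimately have "- eval (\<phi> \<alpha>) y = eval (\<phi> \<alpha>) (reflection \<alpha> y)"
        by (metis eval_uminus eval_act_weyl[OF R weyl_group_incl[OF \<alpha>]] inv_reflection[OF nz])
      also have "\<dots> = eval (\<phi> \<alpha>) y"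
        using quasi_invariant_int[OF _ \<alpha> x, of "\<phi> \<alpha>" m j] Q j
        by (simp add: yx reflection_half_coroot(1)[OF nz x] image_subset_iff)
      finally show "eval (\<phi> \<alpha>) y = 0" by simp
    qed
  qed
  \<comment> \<open>Both sides are derivations, so they need comparing only on linear forms, where
    invariance is the equivariance of \<open>\<phi>\<close>.\<close>
  moreover have "act_der w L = L" if w: "w \<in> weyl_group R" for w
  proof (rule Der_eqI[OF act_der_Der[OF R w Der] Der])
    fix v
    note w' = weyl_group_properties(4)[OF R w]
    show "act_der w L (linear_form v) = L (linear_form v)"
      by (simp add: act_der_def act_linear_form[OF R w'] L\<phi> W_linearD(5)[OF \<phi> w']
          act_inv[OF R w])
  qed
  ultimately have "L \<in> D_Cat_W R m" by (simp add: D_Cat_W_def)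
  with L\<phi> that show thesis by blast
qed


section \<open>Invariant derivations as a module over invariant polynomials\<close>

lemma invariant_ring_Const:
  assumes "root_system R"
  shows "Const c \<in> invariant_ring (weyl_group R)"
  by (auto simp: invariant_ring_def eval_act_weyl[OF assms] intro!: pol_eqI)

lemma D_Cat_W_scale:
  assumes R: "root_system R" and f: "f \<in> invariant_ring (weyl_group R)" and L: "L \<in> D_Cat_W R m"
  shows "scale_fun f L \<in> D_Cat_W R m"
proof -
  have "scale_fun f L \<in> Der"
    using L by (auto simp: D_Cat_W_def D_Cat_def Der_def linear_cscale_iff scale_fun_def
        cscale_def algebra_simps)
  moreover have "act_der w (scale_fun f L) = scale_fun f (act_der w L)" if "w \<in> weyl_group R" for w
    using f that by (simp add: act_der_def scale_fun_def act_mult[OF R] invariant_ring_def)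
  ultimately show ?thesis
    using L by (simp add: D_Cat_W_def D_Cat_def scale_fun_def)
qed

lemma D_Cat_W_zero: "(\<lambda>p. 0) \<in> D_Cat_W R m"
  by (simp add: D_Cat_W_def D_Cat_def Der_def linear_cscale_iff act_der_def act_zero)

lemma D_Cat_W_add:
  assumes R: "root_system R" and L: "L \<in> D_Cat_W R m" "M \<in> D_Cat_W R m"
  shows "(\<lambda>p. L p + M p) \<in> D_Cat_W R m"
proof -
  have "(\<lambda>p. L p + M p) \<in> Der"
    using L by (simp add: D_Cat_W_def D_Cat_def Der_def linear_cscale_iff algebra_simps
        pol.scale_right_distrib)
  moreover have "act_der w (\<lambda>p. L p + M p) = (\<lambda>p. act_der w L p + act_der w M p)"
    if "w \<in> weyl_group R" for w
    using that by (simp add: act_der_def act_add[OF R])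
  ultimately show ?thesis
    using L by (simp add: D_Cat_W_def D_Cat_def)
qed

lemma D_Cat_W_diff:
  assumes R: "root_system R" and L: "L \<in> D_Cat_W R m" "M \<in> D_Cat_W R m"
  shows "(\<lambda>p. L p - M p) \<in> D_Cat_W R m"
proof -
  have "Const (- 1) * p = - p" for p :: "'a pol"
    by (rule pol_eqI) (simp add: eval_simps)
  thus ?thesis
    using D_Cat_W_add[OF R L(1) D_Cat_W_scale[OF R invariant_ring_Const[OF R] L(2), of "- 1"]]
    by (simp add: scale_fun_def)
qed

section \<open>The isotypic component\<close>

lemma Q_tr_subspace: "module.subspace cscale (Q_tr R m)"
  by (simp add: pol.subspace_def Q_tr_def eval_simps)

lemma Q_tr_V_subspace: "module.subspace cscale (Q_tr_V R m)"
  by (simp add: Q_tr_V_def isotypic_V_def)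

lemma Q_tr_V_subset: "Q_tr_V R m \<subseteq> Q_tr R m"
  unfolding Q_tr_V_def isotypic_V_def by (rule pol.span_minimal) (auto intro: Q_tr_subspace)

text \<open>By \<open>W_linear_kernel_trivial\<close> a nonzero \<open>\<phi>\<close> is injective,
  so its range is a copy of \<open>V\<close>, one of the submodules spanning the component.\<close>

lemma W_linear_in_Q_tr_V:
  assumes R: "root_system R" and irr: "irreducible_roots R"
    and \<phi>: "W_linear (weyl_group R) \<phi>" and Q: "range \<phi> \<subseteq> Q_tr R m"
  shows "\<phi> v \<in> Q_tr_V R m"
proof (cases "\<exists>u. u \<noteq> 0 \<and> \<phi> u = 0")
  case True
  hence "\<phi> v = 0" using W_linear_kernel_trivial[OF R irr \<phi>] by blast
  thus ?thesis using pol.subspace_0[OF Q_tr_V_subspace] by simp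
next
  case False
  have "inj \<phi>"
  proof (rule injI)
    fix x y assume "\<phi> x = \<phi> y"
    hence "\<phi> (x - y) = 0" by (simp add: W_linearD[OF \<phi>])
    with False have "x - y = 0" by blast
    thus "x = y" by simp
  qed
  hence "bij_betw \<phi> UNIV (range \<phi>)" by (simp add: bij_betw_def)
  with Q \<phi> have "\<phi> v \<in> \<Union> {U. U \<subseteq> Q_tr R m \<and> (\<exists>\<phi>. W_linear (weyl_group R) \<phi> \<and> bij_betw \<phi> UNIV U)}"
    by blast
  thus ?thesis unfolding Q_tr_V_def isotypic_V_def by (rule pol.span_base)
qed

lemma D_Cat_W_in_Q_tr_V:
  assumes R: "root_system R" and irr: "irreducible_roots R" and L: "L \<in> D_Cat_W R m"
  shows "L (linear_form v) \<in> Q_tr_V R m"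
  using W_linear_in_Q_tr_V[OF R irr D_Cat_W_W_linear[OF R L]] D_Cat_W_quasi_invariant[OF R L]
  by blast

text \<open>Needed for surjectivity of evaluation. Each copy of \<open>V\<close> comes from one
  invariant derivation; expanding its vectors in the coordinate basis gives all summands the same
  index set, so they add termwise.\<close>

lemma Q_tr_V_decomposition:
  fixes R :: "(complex ^ 'n) set"
  assumes R: "root_system R" and q: "q \<in> Q_tr_V R m"
  shows "\<exists>L :: 'n \<Rightarrow> _. (\<forall>i. L i \<in> D_Cat_W R m) \<and> q = (\<Sum>i\<in>UNIV. L i (linear_form (axis i 1)))"
  using q unfolding Q_tr_V_def isotypic_V_def
proof (induction rule: pol.span_induct_alt)
  case base
  show ?case by (intro exI[of _ "\<lambda>i p. 0"]) (simp add: D_Cat_W_zero)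
next
  case (step c x y)
  then obtain U \<phi> v L where "U \<subseteq> Q_tr R m" and \<phi>: "W_linear (weyl_group R) \<phi>" "bij_betw \<phi> UNIV U"
    and x: "x = \<phi> v" and L: "\<forall>i. L i \<in> D_Cat_W R m" and y: "y = (\<Sum>i\<in>UNIV. L i (linear_form (axis i 1)))"
    by (auto simp: bij_betw_def)
  then obtain M where M: "M \<in> D_Cat_W R m" "\<And>v. M (linear_form v) = \<phi> v"
    using W_linear_D_Cat_W[OF R \<phi>(1)] by (metis bij_betw_def)
  interpret Vector_Spaces.linear "(*s)" cscale \<phi> using \<phi> by (simp add: W_linear_def)
  have "x = \<phi> (\<Sum>i\<in>UNIV. v $ i *s axis i 1)" by (simp add: basis_expansion x)
  hence "x = (\<Sum>i\<in>UNIV. cscale (v $ i) (M (linear_form (axis i 1))))" by (simp add: sum scale M(2))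
  hence "cscale c x + y = (\<Sum>i\<in>UNIV. scale_fun (Const (c * v $ i)) M (linear_form (axis i 1)) +
    L i (linear_form (axis i 1)))"
    by (simp add: y sum.distrib pol.scale_sum_right scale_fun_def flip: cscale_def)
  moreover have "(\<lambda>p. scale_fun (Const (c * v $ i)) M p + L i p) \<in> D_Cat_W R m" for i
    using D_Cat_W_add[OF R D_Cat_W_scale[OF R invariant_ring_Const[OF R] M(1)]] L by blast
  ultimately show ?case
    by (intro exI[of _ "\<lambda>i p. scale_fun (Const (c * v $ i)) M p + L i p"]) simp
qed

section \<open>The tensor product\<close>

text \<open>Evaluation before passing to the quotient: the additive extension of
  \<open>L (linear_form v)\<close> from pairs to the free abelian group. \<open>of_int\<close>
  embeds the multiplicities into the polynomial ring.\<close>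

definition tensor_eval :: "(('n pol \<Rightarrow> 'n pol) \<times> (complex ^ 'n) \<Rightarrow>\<^sub>0 int) \<Rightarrow> 'n::finite pol" where
  "tensor_eval z = (\<Sum>x\<in>Poly_Mapping.keys z. of_int (Poly_Mapping.lookup z x) * fst x (linear_form (snd x)))"

lemma tensor_eval_superset:
  assumes "finite S" "Poly_Mapping.keys z \<subseteq> S"
  shows "tensor_eval z = (\<Sum>x\<in>S. of_int (Poly_Mapping.lookup z x) * fst x (linear_form (snd x)))"
  unfolding tensor_eval_def using assms
  by (intro sum.mono_neutral_left) (auto simp: in_keys_iff)

lemma tensor_eval_add: "tensor_eval (y + z) = tensor_eval y + tensor_eval z"
proof -
  let ?S = "Poly_Mapping.keys y \<union> Poly_Mapping.keys z"
  show ?thesis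
    by (subst (1 2 3) tensor_eval_superset[where S = ?S])
       (auto simp: keys_add lookup_add sum.distrib algebra_simps)
qed

lemma tensor_eval_zero: "tensor_eval 0 = 0"
  by (simp add: tensor_eval_def)

lemma tensor_eval_uminus: "tensor_eval (- z) = - tensor_eval z"
  using tensor_eval_add[of z "- z"] by (simp add: tensor_eval_zero eq_neg_iff_add_eq_0 add.commute)

lemma tensor_eval_diff: "tensor_eval (y - z) = tensor_eval y - tensor_eval z"
  using tensor_eval_add[of y "- z"] by (simp add: tensor_eval_uminus)

lemma tensor_eval_sum: "tensor_eval (sum f A) = (\<Sum>a\<in>A. tensor_eval (f a))"
  by (induction A rule: infinite_finite_induct) (auto simp: tensor_eval_zero tensor_eval_add)

lemma tensor_eval_frag_of: "tensor_eval (frag_of (L, v)) = L (linear_form v)"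
  by (simp add: tensor_eval_def keys_frag_of)

section \<open>The relations of the tensor product\<close>

abbreviation D_Cat_W_tensor_rels ::
    "(complex ^ 'n) set \<Rightarrow> (complex ^ 'n \<Rightarrow> nat) \<Rightarrow> (('n::finite pol \<Rightarrow> 'n pol) \<times> (complex ^ 'n) \<Rightarrow>\<^sub>0 int) set"
  where "D_Cat_W_tensor_rels R m \<equiv>
    tensor_rels (D_Cat_W_group R m) (\<lambda>c. scale_fun (Const c)) V_group (*s)"

lemma D_Cat_W_tensor_rels_subgroup:
  assumes R: "root_system R"
  shows "subgroup (D_Cat_W_tensor_rels R m) (free_Abelian_group (D_Cat_W R m \<times> UNIV))"
proof -
  have keys: "Poly_Mapping.keys (x - y) \<subseteq> S"
    if "Poly_Mapping.keys x \<subseteq> S" "Poly_Mapping.keys y \<subseteq> S"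
    for x y :: "('a pol \<Rightarrow> 'a pol) \<times> (complex ^ 'a) \<Rightarrow>\<^sub>0 int" and S
    using that keys_diff[of x y] by blast
  show ?thesis
    unfolding tensor_rels_def D_Cat_W_group_def V_group_def
    by (simp, rule group.generate_is_subgroup[OF group_free_Abelian_group], rule subsetI)
       (elim UnE CollectE exE conjE; simp only: carrier_free_Abelian_group_iff; intro keys;
        simp add: keys_frag_of D_Cat_W_add[OF R] D_Cat_W_scale[OF R invariant_ring_Const[OF R]])
qed

lemma D_Cat_W_tensor_rels_closed:
  fixes R :: "(complex ^ 'n) set"
  assumes R: "root_system R"
  shows "0 \<in> D_Cat_W_tensor_rels R m"
    and "x \<in> D_Cat_W_tensor_rels R m \<Longrightarrow> y \<in> D_Cat_W_tensor_rels R m \<Longrightarrow> x + y \<in> D_Cat_W_tensor_rels R m"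
    and "x \<in> D_Cat_W_tensor_rels R m \<Longrightarrow> - x \<in> D_Cat_W_tensor_rels R m"
    and "x \<in> D_Cat_W_tensor_rels R m \<Longrightarrow> y \<in> D_Cat_W_tensor_rels R m \<Longrightarrow> x - y \<in> D_Cat_W_tensor_rels R m"
    and "(\<And>a. f a \<in> D_Cat_W_tensor_rels R m) \<Longrightarrow> sum f A \<in> D_Cat_W_tensor_rels R m"
proof -
  note sub = D_Cat_W_tensor_rels_subgroup[OF R, of m]
  show zero: "0 \<in> D_Cat_W_tensor_rels R m"
    using subgroup.one_closed[OF sub] by simp
  show add: "x + y \<in> D_Cat_W_tensor_rels R m"
    if "x \<in> D_Cat_W_tensor_rels R m" "y \<in> D_Cat_W_tensor_rels R m" for x y
    using subgroup.m_closed[OF sub that] by simp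
  show uminus: "- x \<in> D_Cat_W_tensor_rels R m" if "x \<in> D_Cat_W_tensor_rels R m" for x
    using subgroup.m_inv_closed[OF sub that] subgroup.mem_carrier[OF sub that] by simp
  show "x - y \<in> D_Cat_W_tensor_rels R m"
    if "x \<in> D_Cat_W_tensor_rels R m" "y \<in> D_Cat_W_tensor_rels R m"
    using add[OF that(1) uminus[OF that(2)]] by simp
  show "sum f A \<in> D_Cat_W_tensor_rels R m" if "\<And>a. f a \<in> D_Cat_W_tensor_rels R m"
    using that by (induction A rule: infinite_finite_induct) (auto intro: zero add)
qed

lemma D_Cat_W_tensor_rels_basic:
  fixes L M :: "'n::finite pol \<Rightarrow> 'n pol"
  assumes L: "L \<in> D_Cat_W R m"
  shows "M \<in> D_Cat_W R m \<Longrightarrow>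
      frag_of (\<lambda>p. L p + M p, v) - frag_of (L, v) - frag_of (M, v) \<in> D_Cat_W_tensor_rels R m"
    and "frag_of (L, v + w) - frag_of (L, v) - frag_of (L, w) \<in> D_Cat_W_tensor_rels R m"
    and "frag_of (scale_fun (Const c) L, v) - frag_of (L, c *s v) \<in> D_Cat_W_tensor_rels R m"
proof -
  show "frag_of (\<lambda>p. L p + M p, v) - frag_of (L, v) - frag_of (M, v) \<in> D_Cat_W_tensor_rels R m"
    if "M \<in> D_Cat_W R m"
    unfolding tensor_rels_def D_Cat_W_group_def V_group_def
    by (rule generate.incl, rule UnI1, rule UnI1, rule CollectI,
        rule exI[of _ L], rule exI[of _ M], rule exI[of _ v]) (simp add: L that)
  show "frag_of (L, v + w) - frag_of (L, v) - frag_of (L, w) \<in> D_Cat_W_tensor_rels R m"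
    unfolding tensor_rels_def D_Cat_W_group_def V_group_def
    by (rule generate.incl, rule UnI1, rule UnI2, rule CollectI,
        rule exI[of _ L], rule exI[of _ v], rule exI[of _ w]) (simp add: L)
  show "frag_of (scale_fun (Const c) L, v) - frag_of (L, c *s v) \<in> D_Cat_W_tensor_rels R m"
    unfolding tensor_rels_def D_Cat_W_group_def V_group_def
    by (rule generate.incl, rule UnI2, rule CollectI,
        rule exI[of _ c], rule exI[of _ L], rule exI[of _ v]) (simp add: L)
qed

text \<open>A normal form modulo the relations: pure tensors are expanded in the coordinate basis
  with the scalars moved to the left factor, and differences are taken coefficientwise.\<close>

lemma tensor_reduce:
  fixes R :: "(complex ^ 'n) set"
  assumes R: "root_system R" and z: "Poly_Mapping.keys z \<subseteq> D_Cat_W R m \<times> UNIV"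
  shows "\<exists>L :: 'n \<Rightarrow> _. (\<forall>i. L i \<in> D_Cat_W R m) \<and>
    z - (\<Sum>i\<in>UNIV. frag_of (L i, axis i 1)) \<in> D_Cat_W_tensor_rels R m"
  using z
proof (induction z rule: frag_induction)
  case zero
  \<comment> \<open>The additivity relation for \<open>0 + 0 = 0\<close> collapses to minus the
    pair.\<close>
  have "- frag_of (\<lambda>p. 0, v) \<in> D_Cat_W_tensor_rels R m" for v
    using D_Cat_W_tensor_rels_basic(1)[OF D_Cat_W_zero D_Cat_W_zero, of v R m] by simp
  hence "(\<Sum>i\<in>UNIV. - frag_of (\<lambda>p. 0, axis i 1)) \<in> D_Cat_W_tensor_rels R m"
    by (rule D_Cat_W_tensor_rels_closed(5)[OF R])
  thus ?case
    by (intro exI[of _ "\<lambda>i p. 0"]) (simp add: D_Cat_W_zero sum_negf)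
next
  case (one x)
  then obtain M v where x: "x = (M, v)" and M: "M \<in> D_Cat_W R m" by auto
  \<comment> \<open>Additivity in the second factor extends to finite sums; the empty sum rests on
    the relation for \<open>0 + 0 = 0\<close>.\<close>
  have "frag_of (M, sum f A) - (\<Sum>i\<in>A. frag_of (M, f i)) \<in> D_Cat_W_tensor_rels R m"
    for f and A :: "'n set"
  proof (induction A rule: infinite_finite_induct)
    case (insert i A)
    show ?case
      using D_Cat_W_tensor_rels_closed(2)[OF R D_Cat_W_tensor_rels_basic(2)[OF M, of "f i" "sum f A"] insert.IH]
      by (simp add: insert.hyps algebra_simps)
  qed (use D_Cat_W_tensor_rels_closed(3)[OF R D_Cat_W_tensor_rels_basic(2)[OF M, of 0 0]] in simp_all)
  from this[of "\<lambda>i. v $ i *s axis i 1" UNIV]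
  have "frag_of (M, v) - (\<Sum>i\<in>UNIV. frag_of (M, v $ i *s axis i 1)) \<in> D_Cat_W_tensor_rels R m"
    by (simp add: basis_expansion)
  moreover have "(\<Sum>i\<in>UNIV. frag_of (scale_fun (Const (v $ i)) M, axis i 1) - frag_of (M, v $ i *s axis i 1))
      \<in> D_Cat_W_tensor_rels R m"
    by (intro D_Cat_W_tensor_rels_closed(5)[OF R] D_Cat_W_tensor_rels_basic(3)[OF M])
  ultimately have "frag_of (M, v) - (\<Sum>i\<in>UNIV. frag_of (scale_fun (Const (v $ i)) M, axis i 1))
      \<in> D_Cat_W_tensor_rels R m"
    using D_Cat_W_tensor_rels_closed(4)[OF R] by (fastforce simp: sum_subtractf)
  thus ?case
    using D_Cat_W_scale[OF R invariant_ring_Const[OF R] M]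
    by (intro exI[of _ "\<lambda>i. scale_fun (Const (v $ i)) M"]) (simp add: x)
next
  case (diff y z)
  then obtain L M where L: "\<And>i. L i \<in> D_Cat_W R m" "\<And>i. M i \<in> D_Cat_W R m"
    and rels: "y - (\<Sum>i\<in>UNIV. frag_of (L i, axis i 1)) \<in> D_Cat_W_tensor_rels R m"
      "z - (\<Sum>i\<in>UNIV. frag_of (M i, axis i 1)) \<in> D_Cat_W_tensor_rels R m"
    by blast
  define N where "N i = (\<lambda>p. L i p - M i p)" for i
  have N: "N i \<in> D_Cat_W R m" for i using D_Cat_W_diff[OF R] L by (simp add: N_def)
  \<comment> \<open>Read this way, the additivity relation replaces a difference of pairs by the
    pair of the difference.\<close>
  have "(\<lambda>p. N i p + M i p) = L i" for i by (simp add: N_def)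
  hence "frag_of (L i, axis i 1) - frag_of (N i, axis i 1) - frag_of (M i, axis i 1)
      \<in> D_Cat_W_tensor_rels R m" for i
    using D_Cat_W_tensor_rels_basic(1)[OF N L(2), of i i] by simp
  hence "(\<Sum>i\<in>UNIV. frag_of (L i, axis i 1) - frag_of (N i, axis i 1) - frag_of (M i, axis i 1))
      \<in> D_Cat_W_tensor_rels R m"
    by (rule D_Cat_W_tensor_rels_closed(5)[OF R])
  with D_Cat_W_tensor_rels_closed(4)[OF R rels]
  have "(y - (\<Sum>i\<in>UNIV. frag_of (L i, axis i 1)) - (z - (\<Sum>i\<in>UNIV. frag_of (M i, axis i 1)))) +
     (\<Sum>i\<in>UNIV. frag_of (L i, axis i 1) - frag_of (N i, axis i 1) - frag_of (M i, axis i 1))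
      \<in> D_Cat_W_tensor_rels R m"
    by (rule D_Cat_W_tensor_rels_closed(2)[OF R])
  hence "y - z - (\<Sum>i\<in>UNIV. frag_of (N i, axis i 1)) \<in> D_Cat_W_tensor_rels R m"
    by (simp add: sum_subtractf sum.distrib algebra_simps)
  with N show ?case by blast
qed

text \<open>Generators evaluate to zero because \<open>L (linear_form v)\<close> is additive in
  \<open>L\<close> and linear in \<open>v\<close>. Conversely, the normal form of an element of the
  kernel has all \<open>L i = 0\<close> by \<open>W_linear_independent\<close>; this gives
  injectivity of evaluation.\<close>

lemma D_Cat_W_tensor_rels_eq_kernel:
  fixes R :: "(complex ^ 'n) set"
  assumes R: "root_system R" and irr: "irreducible_roots R"
  shows "D_Cat_W_tensor_rels R m =
    {z. Poly_Mapping.keys z \<subseteq> D_Cat_W R m \<times> UNIV \<and> tensor_eval z = 0}"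
proof -
  define gens where "gens =
      {frag_of (L \<otimes>\<^bsub>D_Cat_W_group R m\<^esub> M, v) - frag_of (L, v) - frag_of (M, v) | L M v.
          L \<in> carrier (D_Cat_W_group R m) \<and> M \<in> carrier (D_Cat_W_group R m) \<and> v \<in> carrier V_group} \<union>
       {frag_of (L, v \<otimes>\<^bsub>V_group\<^esub> w) - frag_of (L, v) - frag_of (L, w) | L v w.
          L \<in> carrier (D_Cat_W_group R m) \<and> v \<in> carrier V_group \<and> w \<in> carrier V_group} \<union>
       {frag_of (scale_fun (Const c) L, v) - frag_of (L, c *s v) | c L v.
          L \<in> carrier (D_Cat_W_group R m) \<and> v \<in> carrier (V_group :: (complex ^ 'n) monoid)}"
  have rels: "D_Cat_W_tensor_rels R m = generate (free_Abelian_group (D_Cat_W R m \<times> UNIV)) gens"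
    by (simp add: tensor_rels_def gens_def D_Cat_W_group_def V_group_def)
  have carr: "Poly_Mapping.keys x \<subseteq> D_Cat_W R m \<times> UNIV" if "x \<in> D_Cat_W_tensor_rels R m" for x
    using subgroup.mem_carrier[OF D_Cat_W_tensor_rels_subgroup[OF R] that] by simp
  have gens: "tensor_eval h = 0" if "h \<in> gens" for h
    using that
    by (auto simp: gens_def tensor_eval_diff tensor_eval_frag_of D_Cat_W_group_def V_group_def
        scale_fun_def cscale_def W_linearD(1,2)[OF D_Cat_W_W_linear[OF R]])
  have eval: "tensor_eval z = 0" if "z \<in> D_Cat_W_tensor_rels R m" for z
    using that unfolding rels
  proof (induction rule: generate.induct)
    case (inv h)
    hence "h \<in> D_Cat_W_tensor_rels R m" unfolding rels by (rule generate.incl)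
    from carr[OF this] gens[OF inv] show ?case by (simp add: tensor_eval_uminus)
  qed (simp_all add: tensor_eval_zero tensor_eval_add gens)
  moreover have "z \<in> D_Cat_W_tensor_rels R m"
    if z: "Poly_Mapping.keys z \<subseteq> D_Cat_W R m \<times> UNIV" "tensor_eval z = 0" for z
  proof -
    from tensor_reduce[OF R z(1)] obtain L :: "'n \<Rightarrow> _" where L: "\<And>i. L i \<in> D_Cat_W R m"
      and zL: "z - (\<Sum>i\<in>UNIV. frag_of (L i, axis i 1)) \<in> D_Cat_W_tensor_rels R m"
      by blast
    from eval[OF zL] z(2) have "(\<Sum>i\<in>UNIV. L i (linear_form (axis i 1))) = 0"
      by (simp add: tensor_eval_diff tensor_eval_sum tensor_eval_frag_of)
    hence "L i (linear_form v) = 0" for i v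
      using W_linear_independent[OF R irr D_Cat_W_W_linear[OF R L], of "\<lambda>i. i"] by simp
    \<comment> \<open>A derivation vanishing on linear forms is zero, so only pairs with zero first
      entry remain.\<close>
    hence "L i = (\<lambda>p. 0)" for i
      using L[of i] D_Cat_W_zero[of R m] by (intro Der_eqI) (simp_all add: D_Cat_W_def D_Cat_def)
    with zL have "z - (\<Sum>i\<in>UNIV. frag_of ((\<lambda>p. 0) :: 'n pol \<Rightarrow> 'n pol, axis i 1)) \<in> D_Cat_W_tensor_rels R m"
      by simp
    moreover have "- frag_of (\<lambda>p. 0, v) \<in> D_Cat_W_tensor_rels R m" for v
      using D_Cat_W_tensor_rels_basic(1)[OF D_Cat_W_zero D_Cat_W_zero, of v R m] by simp
    hence "(\<Sum>i\<in>UNIV. - frag_of ((\<lambda>p. 0) :: 'n pol \<Rightarrow> 'n pol, axis i 1)) \<in> D_Cat_W_tensor_rels R m"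
      by (rule D_Cat_W_tensor_rels_closed(5)[OF R])
    ultimately show ?thesis
      using D_Cat_W_tensor_rels_closed(4)[OF R] by (fastforce simp: sum_negf)
  qed
  ultimately show ?thesis using carr by blast
qed

section \<open>Evaluation as an isomorphism\<close>

abbreviation D_Cat_W_tensor ::
    "(complex ^ 'n) set \<Rightarrow> (complex ^ 'n \<Rightarrow> nat) \<Rightarrow> (('n::finite pol \<Rightarrow> 'n pol) \<times> (complex ^ 'n) \<Rightarrow>\<^sub>0 int) set monoid"
  where "D_Cat_W_tensor R m \<equiv>
    tensor (D_Cat_W_group R m) (\<lambda>c. scale_fun (Const c)) V_group (*s)"

lemma Q_tr_V_group: "group (Q_tr_V_module R m)"
proof (rule groupI)
  fix x assume x: "x \<in> carrier (Q_tr_V_module R m)"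
  hence "- x \<in> carrier (Q_tr_V_module R m)"
    using pol.subspace_neg[OF Q_tr_V_subspace] by (simp add: Q_tr_V_module_def)
  thus "\<exists>y\<in>carrier (Q_tr_V_module R m). y \<otimes>\<^bsub>Q_tr_V_module R m\<^esub> x = \<one>\<^bsub>Q_tr_V_module R m\<^esub>"
    by (intro bexI[of _ "- x"]) (simp add: Q_tr_V_module_def)
qed (use pol.subspace_0[OF Q_tr_V_subspace] pol.subspace_add[OF Q_tr_V_subspace]
     in \<open>simp_all add: Q_tr_V_module_def add.assoc\<close>)

lemma tensor_eval_in_Q_tr_V:
  assumes R: "root_system R" and irr: "irreducible_roots R"
    and z: "Poly_Mapping.keys z \<subseteq> D_Cat_W R m \<times> UNIV"
  shows "tensor_eval z \<in> Q_tr_V R m"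
  using z
proof (induction z rule: frag_induction)
  case (one x)
  thus ?case using D_Cat_W_in_Q_tr_V[OF R irr] by (cases x) (auto simp: tensor_eval_frag_of)
qed (simp_all add: tensor_eval_zero tensor_eval_diff pol.subspace_0[OF Q_tr_V_subspace]
      pol.subspace_diff[OF Q_tr_V_subspace])

text \<open>The first isomorphism theorem for \<open>tensor_eval\<close>: the kernel is the group of
  relations, and \<open>Q_tr_V_decomposition\<close> gives surjectivity. \<open>the_elem\<close>
  picks the common value on a coset.\<close>

lemma tensor_eval_iso:
  fixes R :: "(complex ^ 'n) set"
  assumes R: "root_system R" and irr: "irreducible_roots R"
  shows "(\<lambda>Z. the_elem (tensor_eval ` Z)) \<in> iso (D_Cat_W_tensor R m) (Q_tr_V_module R m)"
proof -
  let ?F = "free_Abelian_group (D_Cat_W R m \<times> (UNIV :: (complex ^ 'n) set))"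
  interpret group_hom ?F "Q_tr_V_module R m" tensor_eval
    unfolding group_hom_def group_hom_axioms_def hom_def
    using tensor_eval_in_Q_tr_V[OF R irr]
    by (auto simp: Q_tr_V_group, simp_all add: Q_tr_V_module_def tensor_eval_add)
  have "q \<in> tensor_eval ` carrier ?F" if q: "q \<in> Q_tr_V R m" for q
  proof -
    from Q_tr_V_decomposition[OF R q] obtain L :: "'n \<Rightarrow> _" where
      L: "\<And>i. L i \<in> D_Cat_W R m" "q = (\<Sum>i\<in>UNIV. L i (linear_form (axis i 1)))" by blast
    let ?z = "\<Sum>i\<in>UNIV. frag_of (L i, axis i 1)"
    have "?z \<in> carrier ?F"
      using L(1) by (intro sum_closed_free_Abelian_group) simp
    moreover have "q = tensor_eval ?z"
      by (simp add: L(2) tensor_eval_sum tensor_eval_frag_of)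
    ultimately show ?thesis by blast
  qed
  hence "tensor_eval ` carrier ?F = carrier (Q_tr_V_module R m)"
    using tensor_eval_in_Q_tr_V[OF R irr] by (auto simp: Q_tr_V_module_def)
  moreover have "kernel ?F (Q_tr_V_module R m) tensor_eval = D_Cat_W_tensor_rels R m"
    by (auto simp: D_Cat_W_tensor_rels_eq_kernel[OF R irr] kernel_def Q_tr_V_module_def)
  ultimately show ?thesis
    using FactGroup_iso_set by (simp add: tensor_def D_Cat_W_group_def V_group_def)
qed

text \<open>Serves both actions of the second isomorphism. \<open>tensor_eval\<close> intertwines
  the induced map \<open>F\<close> on the free group with \<open>c\<close>, so \<open>F\<close>
  preserves the kernel, that is the relations, and descends to cosets.\<close>

lemma tensor_map_transport:
  fixes R :: "(complex ^ 'n) set"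
  assumes R: "root_system R" and irr: "irreducible_roots R" and Z: "Z \<in> carrier (D_Cat_W_tensor R m)"
    and f: "\<And>L. L \<in> D_Cat_W R m \<Longrightarrow> f L \<in> D_Cat_W R m"
    and eq: "\<And>L v. L \<in> D_Cat_W R m \<Longrightarrow> f L (linear_form (g v)) = c (L (linear_form v))"
    and c: "c 0 = 0" "\<And>p q. c (p - q) = c p - c q"
  defines "Z' \<equiv> tensor_map (D_Cat_W_group R m) (\<lambda>c. scale_fun (Const c)) V_group (*s) f g Z"
  shows "Z' \<in> carrier (D_Cat_W_tensor R m)"
    and "the_elem (tensor_eval ` Z') = c (the_elem (tensor_eval ` Z))"
proof -
  let ?F = "free_Abelian_group (D_Cat_W R m \<times> (UNIV :: (complex ^ 'n) set))"
  let ?T = "D_Cat_W_tensor_rels R m"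
  define F where "F = frag_extend (\<lambda>(a, b). frag_of (f a, g b))"
  have coset: "r_coset ?F ?T z = {t + z | t. t \<in> ?T}" for z
    by (auto simp: r_coset_def)
  have carr: "carrier (D_Cat_W_tensor R m) = {r_coset ?F ?T z | z. Poly_Mapping.keys z \<subseteq> D_Cat_W R m \<times> UNIV}"
    by (auto simp: tensor_def FactGroup_def RCOSETS_def D_Cat_W_group_def V_group_def)
  have F: "Poly_Mapping.keys (F z) \<subseteq> D_Cat_W R m \<times> UNIV \<and> tensor_eval (F z) = c (tensor_eval z)"
    if "Poly_Mapping.keys z \<subseteq> D_Cat_W R m \<times> UNIV" for z
    using that
  proof (induction z rule: frag_induction)
    case zero
    show ?case by (simp add: F_def tensor_eval_zero c)
  next
    case (one x)
    thus ?case by (cases x) (auto simp: F_def keys_frag_of tensor_eval_frag_of f eq)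
  next
    case (diff a b)
    thus ?case using keys_diff[of "F a" "F b"]
      by (auto simp: F_def frag_extend_diff tensor_eval_diff c)
  qed
  have T: "F t \<in> ?T" if "t \<in> ?T" for t
    using that F[of t] by (simp add: D_Cat_W_tensor_rels_eq_kernel[OF R irr] c)
  \<comment> \<open>Evaluation is constant on cosets since the relations form its kernel, so any
    representative gives the value.\<close>
  have the: "the_elem (tensor_eval ` r_coset ?F ?T z) = tensor_eval z" for z
  proof -
    have z: "z \<in> r_coset ?F ?T z"
      using D_Cat_W_tensor_rels_closed(1)[OF R, of m] by (auto simp: coset)
    have eq: "tensor_eval y = tensor_eval z" if "y \<in> r_coset ?F ?T z" for y
      using that unfolding coset by (auto simp: tensor_eval_add D_Cat_W_tensor_rels_eq_kernel[OF R irr])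
    show ?thesis using z by (intro the_elem_image_unique eq) blast
  qed
  from Z carr obtain z where z: "Z = r_coset ?F ?T z" "Poly_Mapping.keys z \<subseteq> D_Cat_W R m \<times> UNIV"
    by auto
  have "Z' = {t + F x | t x. t \<in> ?T \<and> x \<in> Z}"
    by (auto simp: Z'_def tensor_map_def set_mult_def F_def D_Cat_W_group_def V_group_def)
  \<comment> \<open>\<open>F\<close> sends the coset of \<open>z\<close> into that of
    \<open>F z\<close>; adding the relations back, as \<open>tensor_map\<close> does, fills
    it.\<close>
  also have "\<dots> = r_coset ?F ?T (F z)"
  proof (intro equalityI subsetI)
    fix y assume "y \<in> {t + F x | t x. t \<in> ?T \<and> x \<in> Z}"
    then obtain t u where tu: "y = t + F (u + z)" "t \<in> ?T" "u \<in> ?T" by (auto simp: z coset)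
    hence "y = (t + F u) + F z" by (simp add: F_def frag_extend_add)
    moreover have "t + F u \<in> ?T" by (intro D_Cat_W_tensor_rels_closed(2)[OF R] T tu)
    ultimately show "y \<in> r_coset ?F ?T (F z)" by (auto simp: coset)
  next
    fix y assume "y \<in> r_coset ?F ?T (F z)"
    moreover have "z \<in> Z"
      using D_Cat_W_tensor_rels_closed(1)[OF R, of m] by (force simp: z coset)
    ultimately show "y \<in> {t + F x | t x. t \<in> ?T \<and> x \<in> Z}" by (auto simp: coset)
  qed
  finally have Z': "Z' = r_coset ?F ?T (F z)" .
  show "Z' \<in> carrier (D_Cat_W_tensor R m)" using F[OF z(2)] by (auto simp: carr Z')
  show "the_elem (tensor_eval ` Z') = c (the_elem (tensor_eval ` Z))"
    using F[OF z(2)] by (simp add: Z' z(1) the)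
qed

section \<open>The two isomorphisms of modules\<close>

text \<open>Restriction to linear forms is injective by \<open>Der_eqI\<close> and surjective by
  \<open>W_linear_D_Cat_W\<close>. It commutes with multiplication by any polynomial, and
  \<open>gact\<close> is trivial on both sides, so \<open>A\<close> and \<open>W\<close> may be
  arbitrary.\<close>

lemma D_Cat_W_iso_Hom:
  fixes R :: "(complex ^ 'n) set"
  assumes R: "root_system R" and irr: "irreducible_roots R"
  shows "gmodule_iso A W (D_Cat_W_module R m) (Hom_V_Q_module R m)"
proof -
  let ?\<theta> = "\<lambda>(L :: 'n pol \<Rightarrow> 'n pol) v. L (linear_form v)"
  have carr: "carrier (D_Cat_W_module R m) = D_Cat_W R m"
    "carrier (Hom_V_Q_module R m) = Hom_W (weyl_group R) (Q_tr_V R m)"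
    by (simp_all add: D_Cat_W_module_def D_Cat_W_group_def Hom_V_Q_module_def monoid.defs)
  have mem: "?\<theta> L \<in> Hom_W (weyl_group R) (Q_tr_V R m)" if "L \<in> D_Cat_W R m" for L
    using D_Cat_W_W_linear[OF R that] D_Cat_W_in_Q_tr_V[OF R irr that] by (auto simp: Hom_W_def)
  have "bij_betw ?\<theta> (D_Cat_W R m) (Hom_W (weyl_group R) (Q_tr_V R m))"
    unfolding bij_betw_def
  proof (intro conjI equalityI subsetI)
    show "inj_on ?\<theta> (D_Cat_W R m)"
      by (intro inj_onI Der_eqI) (auto simp: D_Cat_W_def D_Cat_def dest: fun_cong)
    fix \<phi> assume "\<phi> \<in> Hom_W (weyl_group R) (Q_tr_V R m)"
    hence "W_linear (weyl_group R) \<phi>" "range \<phi> \<subseteq> Q_tr_V R m"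
      by (simp_all add: Hom_W_def)
    then obtain L where "L \<in> D_Cat_W R m" "\<And>v. L (linear_form v) = \<phi> v"
      using W_linear_D_Cat_W[OF R _ subset_trans[OF _ Q_tr_V_subset]] by blast
    thus "\<phi> \<in> ?\<theta> ` D_Cat_W R m" by (intro image_eqI[of _ _ L]) (auto simp: fun_eq_iff)
  qed (use mem in auto)
  hence "?\<theta> \<in> iso (D_Cat_W_module R m) (Hom_V_Q_module R m)"
    using mem
    by (auto simp: iso_def hom_def carr)
       (simp add: D_Cat_W_module_def D_Cat_W_group_def Hom_V_Q_module_def monoid.defs)
  thus ?thesis
    unfolding gmodule_iso_def
    by (intro bexI[of _ ?\<theta>])
       (simp_all add: D_Cat_W_module_def Hom_V_Q_module_def monoid.defs gmodule.defs scale_fun_def)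
qed

text \<open>The isomorphism is the inverse of evaluation. Both actions are compared after
  evaluating, which is injective, by means of \<open>tensor_map_transport\<close>.\<close>

lemma Q_tr_V_iso_tensor:
  fixes R :: "(complex ^ 'n) set"
  assumes R: "root_system R" and irr: "irreducible_roots R"
  shows "gmodule_iso (invariant_ring (weyl_group R)) (weyl_group R)
           (Q_tr_V_module R m) (D_Cat_W_tensor_V_module R m)"
proof -
  let ?T = "D_Cat_W_tensor R m" and ?Q = "Q_tr_V_module R m" and ?M = "D_Cat_W_tensor_V_module R m"
  define \<Psi> where "\<Psi> = (\<lambda>Z. the_elem (tensor_eval ` Z) :: 'n pol)"
  have iso: "\<Psi> \<in> iso ?T ?Q" using tensor_eval_iso[OF R irr] by (simp add: \<Psi>_def)
  hence bij: "bij_betw \<Psi> (carrier ?T) (carrier ?Q)" by (simp add: iso_def)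
  define \<theta> where "\<theta> = inv_into (carrier ?T) \<Psi>"
  have "group ?T"
    unfolding tensor_def
    using normal.factorgroup_is_group[OF comm_group.normal_iff_subgroup[THEN iffD2,
        OF abelian_free_Abelian_group D_Cat_W_tensor_rels_subgroup[OF R]]]
    by (simp add: D_Cat_W_group_def V_group_def)
  hence "\<theta> \<in> iso ?Q ?T" unfolding \<theta>_def by (rule group.iso_set_sym[OF _ iso])
  hence "\<theta> \<in> iso ?Q ?M"
    by (simp add: iso_def hom_def D_Cat_W_tensor_V_module_def Let_def monoid.defs)
  moreover have "\<theta> (c q) = tensor_map (D_Cat_W_group R m) (\<lambda>c. scale_fun (Const c)) V_group (*s) f g (\<theta> q)"
    if q: "q \<in> carrier ?Q"
      and f: "\<And>L. L \<in> D_Cat_W R m \<Longrightarrow> f L \<in> D_Cat_W R m"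
      and eq: "\<And>L v. L \<in> D_Cat_W R m \<Longrightarrow> f L (linear_form (g v)) = c (L (linear_form v))"
      and c: "c 0 = 0" "\<And>p q. c (p - q) = c p - c q" for q f g c
  proof -
    let ?Z = "tensor_map (D_Cat_W_group R m) (\<lambda>c. scale_fun (Const c)) V_group (*s) f g (\<theta> q)"
    have \<theta>q: "\<theta> q \<in> carrier ?T" "\<Psi> (\<theta> q) = q"
      using bij q by (auto simp: \<theta>_def bij_betw_def inv_into_into f_inv_into_f)
    note transport = tensor_map_transport[where f = f and g = g and c = c, OF R irr \<theta>q(1) f eq c]
    have "?Z \<in> carrier ?T" by (rule transport)
    hence "\<theta> (\<Psi> ?Z) = ?Z" unfolding \<theta>_def by (rule bij_betw_inv_into_left[OF bij])
    moreover have "\<Psi> ?Z = c q"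
      using transport(2) \<theta>q(2) by (simp add: \<Psi>_def)
    ultimately show ?thesis by simp
  qed
  note transport = this
  \<comment> \<open>Scaling the derivation by \<open>a\<close> multiplies its values by
    \<open>a\<close>; invariance of \<open>a\<close> keeps the result in
    \<open>D_Cat_W R m\<close>.\<close>
  have "\<theta> (a * q) = tensor_map (D_Cat_W_group R m) (\<lambda>c. scale_fun (Const c)) V_group (*s) (scale_fun a) id (\<theta> q)"
    if "a \<in> invariant_ring (weyl_group R)" "q \<in> carrier ?Q" for a q
    by (rule transport[where c = "(*) a"])
       (use that D_Cat_W_scale[OF R] in \<open>auto simp: scale_fun_def algebra_simps\<close>)
  \<comment> \<open>\<open>W\<close> moves only the second factor; equivariance of
    \<open>L (linear_form v)\<close> in \<open>v\<close> turns this into \<open>act w\<close> on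
    values.\<close>
  moreover have "\<theta> (act w q) = tensor_map (D_Cat_W_group R m) (\<lambda>c. scale_fun (Const c)) V_group (*s) id w (\<theta> q)"
    if w: "w \<in> weyl_group R" and q: "q \<in> carrier ?Q" for w q
  proof (rule transport[where c = "act w"])
    show "act w (p - q) = act w p - act w q" for p q :: "'n pol"
      by (rule pol_eqI) (simp add: eval_act_weyl[OF R w] eval_simps)
  qed (use q w in \<open>auto simp: W_linearD(5)[OF D_Cat_W_W_linear[OF R]] act_zero\<close>)
  ultimately show ?thesis
    unfolding gmodule_iso_def
    by (intro bexI[of _ \<theta>])
       (simp_all add: Q_tr_V_module_def D_Cat_W_tensor_V_module_def Let_def monoid.defs gmodule.defs)
qed

theorem theorem5p2:
  fixes R :: "(complex ^ 'n) set" and m :: "complex ^ 'n \<Rightarrow> nat"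
  assumes "root_system R" and "reduced R" and "irreducible_roots R"
    and "\<forall>w\<in>weyl_group R. \<forall>\<alpha>\<in>R. m (w \<alpha>) = m \<alpha>"
  shows "gmodule_iso (invariant_ring (weyl_group R)) (weyl_group R)
           (D_Cat_W_module R m) (Hom_V_Q_module R m)
       \<and> gmodule_iso (invariant_ring (weyl_group R)) (weyl_group R)
           (Q_tr_V_module R m) (D_Cat_W_tensor_V_module R m)"
  using D_Cat_W_iso_Hom Q_tr_V_iso_tensor assms by blast

end
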